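(* Let $p$ be an odd prime, $a$ an integer with $\gcd(a,p)=1$, and $r$ an even positive integer. Let $F$ denote the $6\times6$ matrix with $2$ on the diagonal, $1$ on the first super- and subdiagonal and $0$ elsewhere. (1) If $p\ne7$, let $q$ be a prime with $q\equiv4\pmod7$ and $\left(\frac{q}{p}\right)=\left(\frac{a}{p}\right)$, let $v$ be an integer with $7p^rv^2\equiv-1\pmod{4q}$, and set $x=\frac{7p^rv^2+12q+1}{28q}$. Then the discriminant module of the positive definite even lattice with $8\times8$ Gram matrix $\begin{pmatrix}2qp^r & p^rv & 0\\ p^rv & 2x & e_1^{\mathrm T}\\ 0 & e_1 & F\end{pmatrix}$ is isometrically isomorphic to $\underline{A}_{p^r}^a$, where $e_1=(1,0,0,0,0,0)^{\mathrm T}$ and $0$ denotes zero blocks. (2) If $p=7$ and $\left(\frac{a}{7}\right)=1$, let $v$ be an integer with $7^{r-1}v^2\equiv-1\pmod{16}$ and $x=\frac{7^rv^2+7}{16}$. Then the discriminant module of the positive definite even lattice with Gram matrix $\begin{pmatrix}8\cdot7^r & 7^rv & 0\\ 7^rv & 2x & e_1^{\mathrm T}\\ 0 & e_1 & F\end{pmatrix}$ is isometrically isomorphic to $\underline{A}_{7^r}^a$. (3) If $p=7$ and $\left(\frac{a}{7}\right)=-1$, let $v$ be an integer with $7^rv^2\equiv1\pmod{20}$ and $x=\frac{7^rv^2+79}{20}$. Then the discriminant module of the positive definite even lattice with $8\times8$ Gram matrix $G=(g_{ij})$ given by $g_{11}=10\cdot7^r$, $g_{12}=g_{21}=7^rv$,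 $g_{22}=2x$, $g_{23}=g_{32}=5$, $g_{33}=4$, $g_{ii}=2$ for $4\le i\le8$, $g_{i,i+1}=g_{i+1,i}=1$ for $3\le i\le7$, and all other entries $0$, is isometrically isomorphic to $\underline{A}_{7^r}^a$. Moreover, in each case $8$ is the least rank of a positive definite even lattice whose discriminant module is isometrically isomorphic to $\underline{A}_{p^r}^a$.
   Context: $\left(\frac{\cdot}{p}\right)$ is the Legendre symbol. A lattice $(L,B)$ is a free $\mathbb{Z}$-module of finite rank with symmetric bilinear $B\colon L\times L\to\mathbb{R}$ whose Gram matrix has nonzero determinant; even means $B(x,y)\in\mathbb{Z}$, $B(x,x)\in2\mathbb{Z}$; positive definite means $B(x,x)>0$ for $x\ne0$. The lattice with Gram matrix $G$ is $\mathbb{Z}^n$ with $B(x,y)=x^{\mathrm T}Gy$. Dual lattice $L^\sharp=\{v\in\mathbb{R}\otimes L: B(v,w)\in\mathbb{Z}\ \forall w\in L\}$; discriminant module $D_L=(L^\sharp/L,\ v+L\mapsto\frac12B(v,v)+\mathbb{Z})$. Finite quadratic modules: finite abelian groups with $Q\colon M\to\mathbb{Q}/\mathbb{Z}$, $Q(nx)=n^2Q(x)$, $Q(x+y)-Q(x)-Q(y)$ bilinear nondegenerate; isometric isomorphism = group isomorphism preserving $Q$. $\underline{A}_{p^r}^a=(\mathbb{Z}/p^r\mathbb{Z},\ x+p^r\mathbb{Z}\mapsto\frac{a}{p^r}x^2+\mathbb{Z})$ for odd $p$, $p\nmid a$. *)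

theory Defs
  imports
    "HOL-Analysis.Analysis"
    "HOL-Algebra.Elementary_Groups"
    "HOL-Number_Theory.Residues"
    "Jordan_Normal_Form.Determinant"
begin

section \<open>Lattices\<close>

text \<open>
  A free \<open>\<int>\<close>-module \<open>L\<close> of finite rank is given inside a real vector space, as the set of
  integral combinations of finitely many vectors that are linearly independent over the reals.
  Then \<open>\<real> \<otimes> L\<close> is \<open>span L\<close>, and the form on \<open>L\<close> is given together with its
  real bilinear extension to \<open>span L\<close>. The values of \<open>B\<close> outside \<open>span L\<close> are irrelevant.
\<close>

definition lattice_basis :: "'v::real_vector set \<Rightarrow> 'v list \<Rightarrow> bool" where
  "lattice_basis L bs \<longleftrightarrow>
     distinct bs \<and> independent (set bs) \<and>
     L = {\<Sum>i<length bs. of_int (c i) *\<^sub>R bs ! i | c :: nat \<Rightarrow> int. True}"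

definition gram_matrix :: "('v \<Rightarrow> 'v \<Rightarrow> real) \<Rightarrow> 'v list \<Rightarrow> real mat" where
  "gram_matrix B bs = Matrix.mat (length bs) (length bs) (\<lambda>(i, j). B (bs ! i) (bs ! j))"

text \<open>
  A change of basis multiplies the Gram determinant by the square of a unit of \<open>\<int>\<close>,
  so it does not matter which basis is used below.
\<close>

definition is_lattice :: "'v::real_vector set \<Rightarrow> ('v \<Rightarrow> 'v \<Rightarrow> real) \<Rightarrow> bool" where
  "is_lattice L B \<longleftrightarrow>
     (\<forall>x \<in> span L. \<forall>y \<in> span L. B x y = B y x) \<and>
     (\<forall>x \<in> span L. \<forall>y \<in> span L. \<forall>z \<in> span L. B (x + y) z = B x z + B y z) \<and>
     (\<forall>c. \<forall>x \<in> span L. \<forall>y \<in> span L. B (c *\<^sub>R x) y = c * B x y) \<and>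
     (\<exists>bs. lattice_basis L bs \<and> Determinant.det (gram_matrix B bs) \<noteq> 0)"

definition lattice_rank :: "'v::real_vector set \<Rightarrow> nat" where
  "lattice_rank L = (THE n. \<exists>bs. lattice_basis L bs \<and> length bs = n)"

definition even_lattice :: "'v::real_vector set \<Rightarrow> ('v \<Rightarrow> 'v \<Rightarrow> real) \<Rightarrow> bool" where
  "even_lattice L B \<longleftrightarrow>
     is_lattice L B \<and> (\<forall>x \<in> L. \<forall>y \<in> L. B x y \<in> \<int>) \<and> (\<forall>x \<in> L. \<exists>k::int. B x x = 2 * of_int k)"

definition positive_definite :: "'v::real_vector set \<Rightarrow> ('v \<Rightarrow> 'v \<Rightarrow> real) \<Rightarrow> bool" where
  "positive_definite L B \<longleftrightarrow> (\<forall>x \<in> L. x \<noteq> 0 \<longrightarrow> B x x > 0)"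

definition dual_lattice :: "'v::real_vector set \<Rightarrow> ('v \<Rightarrow> 'v \<Rightarrow> real) \<Rightarrow> 'v set" where
  "dual_lattice L B = {v \<in> span L. \<forall>w \<in> L. B v w \<in> \<int>}"

lemma lattice_rank_eq_length:
  assumes "lattice_basis L bs"
  shows "lattice_rank L = length bs"
proof -
  have *: "length cs = dim L" if cs: "lattice_basis L cs" for cs
  proof -
    have ind: "independent (set cs)" and dist: "distinct cs"
      and L: "L = {\<Sum>i<length cs. of_int (c i) *\<^sub>R cs ! i | c :: nat \<Rightarrow> int. True}"
      using cs by (auto simp: lattice_basis_def)
    have "set cs \<subseteq> L"
    proof
      fix x assume "x \<in> set cs"
      then obtain k where k: "k < length cs" "x = cs ! k"
        by (auto simp: in_set_conv_nth)
      have "(\<Sum>i<length cs. of_int (if i = k then 1 else 0) *\<^sub>R cs ! i)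
          = (\<Sum>i<length cs. if i = k then cs ! i else 0)"
        by (intro sum.cong) auto
      also have "\<dots> = x"
        using k by simp
      finally show "x \<in> L"
        unfolding L by (auto intro!: exI[of _ "\<lambda>i. if i = k then 1 else 0"])
    qed
    moreover have "L \<subseteq> span (set cs)"
      unfolding L by (auto intro!: span_sum span_scale intro: span_base)
    ultimately have "dim L = card (set cs)"
      using ind by (intro dim_unique[of "set cs"]) auto
    then show ?thesis
      using dist by (simp add: distinct_card)
  qed
  show ?thesis
    unfolding lattice_rank_def using assms * by (intro the_equality) auto
qed

text \<open>The lattice \<open>\<int>\<^sup>n\<close> with the form \<open>x\<^sup>T G y\<close>.\<close>

definition integer_vectors :: "(real ^ 'n) set" where
  "integer_vectors = {x. \<forall>i. vec_nth x i \<in> \<int>}"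

definition gram_form :: "real ^ 'n ^ 'n \<Rightarrow> real ^ 'n \<Rightarrow> real ^ 'n \<Rightarrow> real" where
  "gram_form G x y = inner x (G *v y)"

section \<open>Quadratic modules\<close>

text \<open>
  Abelian groups are written multiplicatively, as usual for \<open>monoid\<close> records. An element of
  \<open>\<rat>/\<int>\<close> is represented by the corresponding coset of \<open>\<int>\<close> in the reals.
\<close>

record 'a quadratic_module = "'a monoid" +
  qform :: "'a \<Rightarrow> real set"

definition mod_Ints :: "real \<Rightarrow> real set" where
  "mod_Ints t = {t + of_int k | k :: int. True}"

definition isometrically_isomorphic ::
    "('a, 'c) quadratic_module_scheme \<Rightarrow> ('b, 'd) quadratic_module_scheme \<Rightarrow> bool" where
  "isometrically_isomorphic M N \<longleftrightarrow>
     (\<exists>f \<in> iso M N. \<forall>x \<in> carrier M. qform N (f x) = qform M x)"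

definition additive_group :: "'v::ab_group_add set \<Rightarrow> 'v monoid" where
  "additive_group A = \<lparr>carrier = A, monoid.mult = (+), one = 0\<rparr>"

text \<open>
  The elements of the quotient are cosets \<open>v + L\<close>. For an even lattice, \<open>B(v, v) / 2\<close> modulo
  \<open>\<int>\<close> is the same for all representatives \<open>v\<close> of a coset, so that the union below
  is a single coset of \<open>\<int>\<close>.
\<close>

definition discriminant_module ::
    "'v::real_vector set \<Rightarrow> ('v \<Rightarrow> 'v \<Rightarrow> real) \<Rightarrow> 'v set quadratic_module" where
  "discriminant_module L B =
     (let D = additive_group (dual_lattice L B) Mod L
      in \<lparr>carrier = carrier D, monoid.mult = monoid.mult D, one = one D,
          qform = (\<lambda>X. \<Union>v\<in>X. mod_Ints (B v v / 2))\<rparr>)"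

text \<open>The module with underlying group \<open>\<int>/p\<^sup>r\<int>\<close> and \<open>Q(x) = a x\<^sup>2 / p\<^sup>r\<close>.\<close>

definition cyclic_module :: "nat \<Rightarrow> nat \<Rightarrow> int \<Rightarrow> int quadratic_module" where
  "cyclic_module p r a =
     (let Z = integer_mod_group (p ^ r)
      in \<lparr>carrier = carrier Z, monoid.mult = monoid.mult Z, one = one Z,
          qform = (\<lambda>x. mod_Ints (of_int a / of_nat (p ^ r) * (of_int x)\<^sup>2))\<rparr>)"

section \<open>The Gram matrices\<close>

text \<open>
  The indices of type \<open>8\<close> are \<open>1, \<dots>, 8\<close>, where \<open>8 = 0\<close>. The lower right
  \<open>6 \<times> 6\<close> block is \<open>F\<close> if \<open>g33 = 2\<close>.
\<close>

definition gram8 :: "real \<Rightarrow> real \<Rightarrow> real \<Rightarrow> real \<Rightarrow> real \<Rightarrow> real ^ 8 ^ 8" where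
  "gram8 g11 g12 g22 g23 g33 = vector
    [vector [g11, g12, 0,   0, 0, 0, 0, 0],
     vector [g12, g22, g23, 0, 0, 0, 0, 0],
     vector [0,   g23, g33, 1, 0, 0, 0, 0],
     vector [0,   0,   1,   2, 1, 0, 0, 0],
     vector [0,   0,   0,   1, 2, 1, 0, 0],
     vector [0,   0,   0,   0, 1, 2, 1, 0],
     vector [0,   0,   0,   0, 0, 1, 2, 1],
     vector [0,   0,   0,   0, 0, 0, 1, 2]]"

end

theory Submission
  imports Defs "HOL-Number_Theory.Euler_Criterion"
begin

text \<open>
  Each Gram matrix has a first column divisible by \<open>p\<^sup>r\<close>, and dividing that column by \<open>p\<^sup>r\<close>
  leaves an integral matrix of determinant \<open>\<plusminus>1\<close>. Hence \<open>e\<^sub>1 / p\<^sup>r\<close> generates the discriminant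
  group, with value \<open>q / p\<^sup>r\<close>, where \<open>q\<close> is replaced by \<open>4\<close> and \<open>5\<close> in the last two cases; as \<open>q\<close>
  and \<open>a\<close> have the same Legendre symbol, they differ by a unit square modulo \<open>p\<^sup>r\<close>.
  A lattice of rank \<open>8\<close> exists without Dirichlet's theorem, because the construction works whenever
  \<open>q \<equiv> 4\<close> modulo \<open>7\<close> and \<open>- 7\<close> is a square modulo \<open>4 q\<close>, for instance for \<open>q = (w\<^sup>2 + 7) / 4\<close>
  with a suitable \<open>w\<close>.

  For the lower bound, a generator \<open>h\<close> of the discriminant group can be chosen such that
  \<open>p\<^sup>r h\<close> belongs to a basis of \<open>L\<close>. Replacing this basis vector by \<open>p\<^bsup>r/2\<^esup> h\<close> gives a basis of an
  even unimodular overlattice. Its rank \<open>n\<close> satisfies \<open>(- 1)\<^bsup>n/2\<^esup> \<equiv> 1\<close> modulo \<open>4\<close>, which leaves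
  only \<open>n = 4\<close> below \<open>8\<close>, and for \<open>n = 4\<close> Hermite's inequality yields a nonzero vector of norm
  less than \<open>2\<close>.
\<close>

section \<open>Even unimodular integer matrices\<close>

text \<open>For even \<open>r\<close> the multiple by \<open>p ^ (r div 2)\<close> of a generator of
  the discriminant group spans an isotropic subgroup equal to its own orthogonal complement; this is
  why a unimodular overlattice exists. The usual proofs that even unimodular positive definite
  lattices have rank divisible by 8 use Gauss sums or theta functions. Only ranks below 8 have to be
  excluded here, so a determinant modulo 4 and Hermite's bound are enough, because (4/3)^6 < 2^4 in
  rank 4. The constants in the matrices come from \<open>F\<close>, which has determinant 7 and 6/7
  as the first diagonal entry of its inverse. After division of the first column the determinant is
  28 q x - 12 q - 7 p^r v^2, and the formula for \<open>x\<close> sets it to 1. Modulo 7 this forces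
  q = 4, a square, so for \<open>p = 7\<close> the block \<open>F\<close> cannot serve a nonresidue
  \<open>a\<close>. In the third matrix the lower block has determinant 19 and the corresponding
  entry is 6/19; the divided determinant is 19 (20 x - p^r v^2) - 1500 = 19 * 79 - 1500 = 1.\<close>

unbundle no inner_syntax
unbundle no vec_syntax
hide_const (open) Determinants.det Finite_Cartesian_Product.mat Finite_Cartesian_Product.vec Finite_Cartesian_Product.transpose

section \<open>Schur complements without division\<close>

text \<open>Block elimination in which a matrix \<open>A\<close> with \<open>A * D\<close> scalar,
  such as the adjugate, replaces the inverse of \<open>D\<close>. The price is the factor
  \<open>\<delta> ^ l\<close>; in return all entries stay in the ring, as the parity and integrality
  arguments require.\<close>

lemma det_schur:
  fixes D C C' E A :: "'a :: idom mat"
  assumes D: "D \<in> carrier_mat k k" and C: "C \<in> carrier_mat k l"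
    and C': "C' \<in> carrier_mat l k" and E: "E \<in> carrier_mat l l"
    and A: "A \<in> carrier_mat k k" and AD: "A * D = \<delta> \<cdot>\<^sub>m 1\<^sub>m k"
  shows "\<delta> ^ l * det (four_block_mat D C C' E) = det D * det (\<delta> \<cdot>\<^sub>m E - C' * A * C)"
proof -
  let ?P = "four_block_mat (1\<^sub>m k) (0\<^sub>m k l) (- (C' * A)) (\<delta> \<cdot>\<^sub>m 1\<^sub>m l)"
  have CA: "C' * A \<in> carrier_mat l k" using C' A by simp
  have "- (C' * A) * D + (\<delta> \<cdot>\<^sub>m 1\<^sub>m l) * C' = 0\<^sub>m l k"
  proof -
    have "- (C' * A) * D = - (C' * (A * D))"
      using C' A D CA by (metis assoc_mult_mat uminus_mult_left_mat carrier_matD)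
    also have "\<dots> = - (\<delta> \<cdot>\<^sub>m C')"
      using C' by (simp add: AD mult_smult_distrib[of _ l k _ k])
    finally show ?thesis using C' by (simp add: mult_smult_assoc_mat[of _ l l _ k])
  qed
  moreover have "- (C' * A) * C + (\<delta> \<cdot>\<^sub>m 1\<^sub>m l) * E = \<delta> \<cdot>\<^sub>m E - C' * A * C"
  proof -
    have "- (C' * A) * C = - (C' * A * C)"
      using CA C by (intro uminus_mult_left_mat) auto
    moreover have "C' * A * C \<in> carrier_mat l l" using CA C by simp
    moreover have "- X + \<delta> \<cdot>\<^sub>m E = \<delta> \<cdot>\<^sub>m E - X" if "X \<in> carrier_mat l l" for X
      using that E by (auto intro!: eq_matI)
    ultimately show ?thesis using E
      by (simp add: mult_smult_assoc_mat[of _ l l _ l])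
  qed
  ultimately have "?P * four_block_mat D C C' E
      = four_block_mat D C (0\<^sub>m l k) (\<delta> \<cdot>\<^sub>m E - C' * A * C)"
    using D C C' E CA by (subst mult_four_block_mat[of _ k k _ l _ l _ _ k _ l]) auto
  moreover have "det (?P * four_block_mat D C C' E) = det ?P * det (four_block_mat D C C' E)"
    using D E by (intro det_mult[of _ "k + l"]) auto
  moreover have "det ?P = \<delta> ^ l"
    using CA by (subst det_four_block_mat_upper_right_zero[of _ k _ l]) auto
  moreover have "det (four_block_mat D C (0\<^sub>m l k) (\<delta> \<cdot>\<^sub>m E - C' * A * C))
      = det D * det (\<delta> \<cdot>\<^sub>m E - C' * A * C)"
    using D C E CA minus_carrier_mat[OF mult_carrier_mat[OF CA C]]
    by (intro det_four_block_mat_lower_left_zero[of _ k _ l]) simp_all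
  ultimately show ?thesis by simp
qed

text \<open>The case of a single pivot. Hermite's inequality uses it to compare the determinant of a
  form with that of its projection.\<close>

lemma det_schur_1:
  fixes g :: "nat \<Rightarrow> nat \<Rightarrow> 'a :: idom"
  shows "g 0 0 ^ l * det (mat (Suc l) (Suc l) (\<lambda>(i, j). g i j))
    = g 0 0 * det (mat l l (\<lambda>(i, j). g 0 0 * g (Suc i) (Suc j) - g (Suc i) 0 * g 0 (Suc j)))"
proof -
  define D where "D = mat 1 1 (\<lambda>(i, j). g 0 0)"
  define C where "C = mat 1 l (\<lambda>(i, j). g 0 (Suc j))"
  define C' where "C' = mat l 1 (\<lambda>(i, j). g (Suc i) 0)"
  define E where "E = mat l l (\<lambda>(i, j). g (Suc i) (Suc j))"
  have "mat (Suc l) (Suc l) (\<lambda>(i, j). g i j) = four_block_mat D C C' E"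
    by (auto intro!: eq_matI simp: D_def C_def C'_def E_def)
  moreover have "g 0 0 ^ l * det (four_block_mat D C C' E) = det D * det (g 0 0 \<cdot>\<^sub>m E - C' * 1\<^sub>m 1 * C)"
    by (rule det_schur[of _ 1 _ l])
      (auto intro!: eq_matI simp: D_def C_def C'_def E_def)
  moreover have "det D = g 0 0"
    by (subst det_single) (auto simp: D_def)
  moreover have "g 0 0 \<cdot>\<^sub>m E - C' * 1\<^sub>m 1 * C
      = mat l l (\<lambda>(i, j). g 0 0 * g (Suc i) (Suc j) - g (Suc i) 0 * g 0 (Suc j))"
    by (auto intro!: eq_matI simp: C_def C'_def E_def scalar_prod_def)
  ultimately show ?thesis by simp
qed

lemma det_2:
  fixes g :: "nat \<Rightarrow> nat \<Rightarrow> 'a :: idom"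
  shows "det (mat 2 2 (\<lambda>(i, j). g i j)) = g 0 0 * g 1 1 - g 0 1 * g 1 0"
proof -
  have *: "mat 2 2 (\<lambda>(i, j). g i j) \<in> carrier_mat 2 2" by simp
  show ?thesis
    by (subst laplace_expansion_row[OF *, of 0])
       (auto simp: numeral_2_eq_2 cofactor_def mat_delete_def det_single)
qed

lemma det_schur_2:
  fixes g :: "nat \<Rightarrow> nat \<Rightarrow> 'a :: idom"
  defines "\<delta> \<equiv> g 0 0 * g 1 1 - g 0 1 * g 1 0"
  shows "\<delta> ^ l * det (mat (Suc (Suc l)) (Suc (Suc l)) (\<lambda>(i, j). g i j))
    = \<delta> * det (mat l l (\<lambda>(i, j). \<delta> * g (i + 2) (j + 2)
        - (g (i + 2) 0 * (g 1 1 * g 0 (j + 2) - g 0 1 * g 1 (j + 2))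
         + g (i + 2) 1 * (g 0 0 * g 1 (j + 2) - g 1 0 * g 0 (j + 2)))))"
proof -
  define D where "D = mat 2 2 (\<lambda>(i, j). g i j)"
  \<comment> \<open>The adjugate of \<open>D\<close>: the diagonal entries are exchanged and the
    others negated.\<close>
  define A where "A = mat 2 2 (\<lambda>(i, j). if i = j then g (1 - i) (1 - j) else - g i j)"
  define C where "C = mat 2 l (\<lambda>(i, j). g i (j + 2))"
  define C' where "C' = mat l 2 (\<lambda>(i, j). g (i + 2) j)"
  define E where "E = mat l l (\<lambda>(i, j). g (i + 2) (j + 2))"
  have "Suc (Suc (i - 2)) = i" if "\<not> i < 2" for i
    using that by simp
  then have "mat (Suc (Suc l)) (Suc (Suc l)) (\<lambda>(i, j). g i j) = four_block_mat D C C' E"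
    by (auto intro!: eq_matI simp: D_def C_def C'_def E_def)
  moreover have "A * D = \<delta> \<cdot>\<^sub>m 1\<^sub>m 2"
    by (rule eq_matI) (auto simp: A_def D_def \<delta>_def scalar_prod_def numeral_2_eq_2
        algebra_simps less_Suc_eq)
  then have "\<delta> ^ l * det (four_block_mat D C C' E) = det D * det (\<delta> \<cdot>\<^sub>m E - C' * A * C)"
    by (intro det_schur[of _ 2 _ l]) (auto simp: D_def C_def C'_def E_def A_def)
  moreover have "det D = \<delta>"
    by (simp add: D_def det_2 \<delta>_def)
  moreover have "\<delta> \<cdot>\<^sub>m E - C' * A * C = mat l l (\<lambda>(i, j). \<delta> * g (i + 2) (j + 2)
        - (g (i + 2) 0 * (g 1 1 * g 0 (j + 2) - g 0 1 * g 1 (j + 2))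
         + g (i + 2) 1 * (g 0 0 * g 1 (j + 2) - g 1 0 * g 0 (j + 2))))"
    by (auto intro!: eq_matI simp: C_def C'_def E_def A_def scalar_prod_def numeral_2_eq_2 algebra_simps)
  ultimately show ?thesis by simp
qed

section \<open>Parity of even symmetric determinants\<close>

text \<open>Rows and columns each contribute the sign of \<open>\<pi>\<close>, and the signs cancel.
  Thus an odd entry can be moved to position \<open>(0, 1)\<close> while determinant and symmetry
  are kept.\<close>

lemma det_permute_both:
  fixes g :: "nat \<Rightarrow> nat \<Rightarrow> 'a :: comm_ring_1"
  assumes "\<pi> permutes {0..<n}"
  shows "det (mat n n (\<lambda>(i, j). g (\<pi> i) (\<pi> j))) = det (mat n n (\<lambda>(i, j). g i j))"
proof -
  have lt: "\<pi> i < n" if "i < n" for i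
    using permutes_in_image[OF assms, of i] that by simp
  have s: "signof \<pi> * signof \<pi> = (1 :: 'a)"
    by (simp add: sign_def)
  have "det (mat n n (\<lambda>(i, j). g (\<pi> i) (\<pi> j)))
      = signof \<pi> * det (mat n n (\<lambda>(i, j). g i (\<pi> j)))"
    by (subst det_permute_rows[OF _ assms, symmetric])
      (auto intro!: arg_cong[of _ _ det] eq_matI simp: lt)
  also have "det (mat n n (\<lambda>(i, j). g i (\<pi> j))) = det (mat n n (\<lambda>(i, j). g j (\<pi> i)))"
    by (subst det_transpose[symmetric, of _ n]) (auto intro!: arg_cong[of _ _ det] eq_matI)
  also have "\<dots> = signof \<pi> * det (mat n n (\<lambda>(i, j). g j i))"
    by (subst det_permute_rows[OF _ assms, symmetric])
      (auto intro!: arg_cong[of _ _ det] eq_matI simp: lt)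
  also have "det (mat n n (\<lambda>(i, j). g j i)) = det (mat n n (\<lambda>(i, j). g i j))"
    by (subst det_transpose[symmetric, of _ n]) (auto intro!: arg_cong[of _ _ det] eq_matI)
  finally show ?thesis using s by (simp flip: mult.assoc)
qed

text \<open>
  An odd entry lies off the diagonal and spans a \<open>2 \<times> 2\<close> block of determinant \<open>- 1\<close> modulo \<open>4\<close>,
  whose Schur complement is again even.
\<close>

lemma even_symmetric_det_mod_4:
  fixes g :: "nat \<Rightarrow> nat \<Rightarrow> int"
  assumes "\<And>i j. i < n \<Longrightarrow> j < n \<Longrightarrow> g i j = g j i" and "\<And>i. i < n \<Longrightarrow> even (g i i)"
    and "odd (det (mat n n (\<lambda>(i, j). g i j)))"
  shows "even n \<and> [det (mat n n (\<lambda>(i, j). g i j)) = (- 1) ^ (n div 2)] (mod 4)"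
  using assms
proof (induction n arbitrary: g rule: less_induct)
  case (less n)
  note sym = less.prems(1) and ev = less.prems(2) and odd = less.prems(3)
  consider "n = 0" | "n = 1" | l where "n = Suc (Suc l)"
    by (metis One_nat_def not0_implies_Suc)
  then show ?case
  proof cases
    case 1
    then show ?thesis by simp
  next
    case 2
    then have "det (mat n n (\<lambda>(i, j). g i j)) = g 0 0"
      by (subst det_single) auto
    with ev[of 0] odd 2 show ?thesis by auto
  next
    case (3 l)
    have "\<exists>i j. i < n \<and> j < n \<and> odd (g i j)"
    proof (rule ccontr)
      assume "\<not> ?thesis"
      then have "mat n n (\<lambda>(i, j). g i j) = 2 \<cdot>\<^sub>m mat n n (\<lambda>(i, j). g i j div 2)"
        by (auto intro!: eq_matI)
      then have "det (mat n n (\<lambda>(i, j). g i j)) = 2 ^ n * det (mat n n (\<lambda>(i, j). g i j div 2))"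
        by (metis det_smult dim_col_mat(1))
      with odd 3 show False by simp
    qed
    then obtain i j where ij: "i < n" "j < n" "odd (g i j)" by blast
    with ev have "i \<noteq> j" by auto
    \<comment> \<open>The outer transposition sends 0 to \<open>i\<close>; the inner one sends 1 to
      the preimage of \<open>j\<close> under it, since \<open>j\<close> itself may be moved.\<close>
    define \<pi> where "\<pi> = transpose 0 i \<circ> transpose 1 (transpose 0 i j)"
    have lt1: "transpose 0 i j < n"
      using ij 3 by (auto simp: Transposition.transpose_def)
    have perm: "\<pi> permutes {0..<n}"
      unfolding \<pi>_def using ij 3 lt1 by (intro permutes_compose permutes_swap_id) auto
    have \<pi>0: "\<pi> 0 = i" using \<open>i \<noteq> j\<close> by (auto simp: \<pi>_def Transposition.transpose_def)
    have \<pi>1: "\<pi> 1 = j" by (auto simp: \<pi>_def)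
    have lt: "\<pi> i < n" if "i < n" for i
      using permutes_in_image[OF perm, of i] that by simp
    define h where "h = (\<lambda>a b. g (\<pi> a) (\<pi> b))"
    have hsym: "h a b = h b a" if "a < n" "b < n" for a b
      using that lt sym by (simp add: h_def)
    have hev: "even (h a a)" if "a < n" for a
      using that lt ev by (simp add: h_def)
    have h01: "odd (h 0 1)" using ij by (simp add: h_def \<pi>0 \<pi>1 del: One_nat_def)
    have deth: "det (mat n n (\<lambda>(i, j). h i j)) = det (mat n n (\<lambda>(i, j). g i j))"
      unfolding h_def by (rule det_permute_both[OF perm])
    define \<delta> where "\<delta> = h 0 0 * h 1 1 - h 0 1 * h 1 0"
    have h10: "h 1 0 = h 0 1" using hsym 3 by simp
    have \<delta>4: "[\<delta> = - 1] (mod 4)"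
    proof -
      obtain u v w where "h 0 0 = 2 * u" "h 1 1 = 2 * v" "h 0 1 = 2 * w + 1"
        using hev[of 0] hev[of 1] h01 3 by (auto elim!: evenE oddE)
      then have "\<delta> - (- 1) = 4 * (u * v - w * w - w)"
        unfolding \<delta>_def h10 by (simp add: algebra_simps)
      then show ?thesis by (simp add: cong_iff_dvd_diff)
    qed
    have odd\<delta>: "odd \<delta>"
      using h01 hev[of 0] 3 by (simp only: \<delta>_def h10) (simp del: One_nat_def)
    define k where "k = (\<lambda>i j. \<delta> * h (i + 2) (j + 2)
        - (h (i + 2) 0 * (h 1 1 * h 0 (j + 2) - h 0 1 * h 1 (j + 2))
         + h (i + 2) 1 * (h 0 0 * h 1 (j + 2) - h 1 0 * h 0 (j + 2))))"
    have detk: "\<delta> ^ l * det (mat n n (\<lambda>(i, j). h i j)) = \<delta> * det (mat l l (\<lambda>(i, j). k i j))"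
      unfolding k_def 3 \<delta>_def by (rule det_schur_2)
    have "odd (det (mat l l (\<lambda>(i, j). k i j)))"
    proof -
      have "odd (\<delta> ^ l * det (mat n n (\<lambda>(i, j). h i j)))"
        using odd odd\<delta> deth by simp
      then show ?thesis unfolding detk by simp
    qed
    moreover have "k a b = k b a" if "a < l" "b < l" for a b
    proof -
      have "h (b + 2) 0 = h 0 (b + 2)" "h (b + 2) 1 = h 1 (b + 2)" "h (a + 2) 0 = h 0 (a + 2)"
        "h (a + 2) 1 = h 1 (a + 2)" "h (a + 2) (b + 2) = h (b + 2) (a + 2)"
        using that 3 by (auto intro!: hsym)
      then show ?thesis unfolding k_def h10 by (simp add: algebra_simps)
    qed
    moreover have "even (k a a)" if "a < l" for a
    proof -
      have "h (a + 2) 0 = h 0 (a + 2)" "h (a + 2) 1 = h 1 (a + 2)"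
        using that 3 by (auto intro!: hsym)
      moreover have "even (h (a + 2) (a + 2))" "even (h 0 0)" "even (h 1 1)"
        using that 3 by (auto intro!: hev)
      ultimately show ?thesis unfolding k_def h10 by (auto simp del: One_nat_def)
    qed
    ultimately have IH: "even l" "[det (mat l l (\<lambda>(i, j). k i j)) = (- 1) ^ (l div 2)] (mod 4)"
      using less.IH[of l k] 3 by auto
    \<comment> \<open>As \<open>l\<close> is even, \<open>\<delta> ^ l\<close> is 1 modulo 4; the
      single factor \<open>\<delta>\<close> on the other side supplies the sign for
      \<open>n div 2 = l div 2 + 1\<close>.\<close>
    have "[\<delta> ^ l * det (mat n n (\<lambda>(i, j). h i j)) = (- 1) ^ l * det (mat n n (\<lambda>(i, j). h i j))] (mod 4)"
      by (intro cong_mult cong_pow \<delta>4 cong_refl)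
    moreover have "[\<delta> * det (mat l l (\<lambda>(i, j). k i j)) = (- 1) * (- 1) ^ (l div 2)] (mod 4)"
      by (intro cong_mult \<delta>4 IH)
    ultimately have "[det (mat n n (\<lambda>(i, j). h i j)) = (- 1) * (- 1) ^ (l div 2)] (mod 4)"
      using IH(1) detk by (simp add: cong_def)
    then show ?thesis using IH(1) 3 deth by simp
  qed
qed

section \<open>Integral quadratic forms and unimodular substitutions\<close>

definition quad_form :: "int mat \<Rightarrow> int vec \<Rightarrow> int" where
  "quad_form G x = x \<bullet> (G *\<^sub>v x)"

definition int_positive_definite :: "nat \<Rightarrow> int mat \<Rightarrow> bool" where
  "int_positive_definite n G \<longleftrightarrow> G \<in> carrier_mat n n \<and> G\<^sup>T = G \<and>
     (\<forall>x \<in> carrier_vec n. x \<noteq> 0\<^sub>v n \<longrightarrow> quad_form G x > 0)"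

definition unimodular :: "nat \<Rightarrow> int mat \<Rightarrow> bool" where
  "unimodular n U \<longleftrightarrow> U \<in> carrier_mat n n \<and> det U * det U = 1"

text \<open>Being a column of a unimodular matrix means belonging to a basis of the integral
  vectors. Compared with coprime coordinates, this form lets a minimal vector become the first basis
  vector at once.\<close>

definition primitive_vec :: "nat \<Rightarrow> int vec \<Rightarrow> bool" where
  "primitive_vec n x \<longleftrightarrow> (\<exists>U. unimodular n U \<and> col U 0 = x)"

lemma quad_form_sum:
  assumes "G \<in> carrier_mat n n" "x \<in> carrier_vec n"
  shows "quad_form G x = (\<Sum>i<n. \<Sum>j<n. G $$ (i, j) * x $ i * x $ j)"
  using assms unfolding quad_form_def scalar_prod_def
  by (auto simp: sum_distrib_left scalar_prod_def lessThan_atLeast0 mult_ac intro!: sum.cong)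

text \<open>Completing the square after multiplication by the pivot. The coefficients left over are
  those of \<open>det_schur_1\<close>, so a form and its determinant descend to the same
  matrix.\<close>

lemma complete_square:
  fixes g :: "nat \<Rightarrow> nat \<Rightarrow> int"
  assumes sym: "\<And>j. j < Suc l \<Longrightarrow> g j 0 = g 0 j"
  shows "g 0 0 * (\<Sum>i<Suc l. \<Sum>j<Suc l. g i j * x i * x j)
    = (\<Sum>j<Suc l. g 0 j * x j)\<^sup>2
      + (\<Sum>i<l. \<Sum>j<l. (g 0 0 * g (Suc i) (Suc j) - g (Suc i) 0 * g 0 (Suc j)) * x (Suc i) * x (Suc j))"
proof -
  define s where "s = (\<Sum>j<l. g 0 (Suc j) * x (Suc j))"
  define t where "t = (\<Sum>i<l. \<Sum>j<l. g (Suc i) (Suc j) * x (Suc i) * x (Suc j))"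
  have s': "(\<Sum>i<l. g (Suc i) 0 * x (Suc i)) = s"
    unfolding s_def by (intro sum.cong) (auto simp: sym)
  have "(\<Sum>i<Suc l. \<Sum>j<Suc l. g i j * x i * x j) = g 0 0 * x 0 * x 0 + x 0 * s
      + ((\<Sum>i<l. g (Suc i) 0 * x (Suc i)) * x 0 + t)"
    unfolding sum.lessThan_Suc_shift s_def t_def
    by (simp add: sum.distrib sum_distrib_left sum_distrib_right algebra_simps)
  moreover have "(\<Sum>j<Suc l. g 0 j * x j) = g 0 0 * x 0 + s"
    unfolding sum.lessThan_Suc_shift s_def by simp
  moreover have "(\<Sum>i<l. \<Sum>j<l. (g 0 0 * g (Suc i) (Suc j) - g (Suc i) 0 * g 0 (Suc j)) * x (Suc i) * x (Suc j))
      = g 0 0 * t - (\<Sum>i<l. g (Suc i) 0 * x (Suc i)) * s"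
    unfolding s_def t_def sum_product
    by (simp add: sum_subtractf sum_distrib_left algebra_simps)
  ultimately show ?thesis
    unfolding s' by (simp add: power2_eq_square algebra_simps)
qed

lemma even_sum_symmetric:
  fixes g :: "nat \<Rightarrow> nat \<Rightarrow> int"
  assumes "\<And>i j. i < n \<Longrightarrow> j < n \<Longrightarrow> g i j = g j i" and "\<And>i. i < n \<Longrightarrow> even (g i i)"
  shows "even (\<Sum>i<n. \<Sum>j<n. g i j * x i * x j)"
  using assms
proof (induction n)
  case (Suc n)
  have "(\<Sum>i<n. g i n * x i * x n) = (\<Sum>i<n. g n i * x n * x i)"
    using Suc.prems(1) by (intro sum.cong) auto
  then have "(\<Sum>i<Suc n. \<Sum>j<Suc n. g i j * x i * x j)
     = (\<Sum>i<n. \<Sum>j<n. g i j * x i * x j) + 2 * (\<Sum>i<n. g n i * x n * x i) + g n n * x n * x n"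
    by (simp add: sum.distrib)
  with Suc show ?case by simp
qed simp

lemma unimodular_one: "unimodular n (1\<^sub>m n)"
  by (simp add: unimodular_def)

lemma unimodular_mult:
  assumes "unimodular n U" "unimodular n V"
  shows "unimodular n (U * V)"
proof -
  have "det (U * V) = det U * det V"
    using assms by (auto simp: unimodular_def intro: det_mult)
  then show ?thesis using assms by (auto simp: unimodular_def algebra_simps)
qed

lemma primitive_vec_image:
  assumes "unimodular n U" "primitive_vec n x" "n > 0"
  shows "primitive_vec n (U *\<^sub>v x)"
proof -
  obtain V where V: "unimodular n V" "col V 0 = x"
    using assms(2) by (auto simp: primitive_vec_def)
  have "col (U * V) 0 = U *\<^sub>v x"
    using V assms by (auto simp: unimodular_def intro!: eq_vecI)
  then show ?thesis using unimodular_mult[OF assms(1) V(1)] by (auto simp: primitive_vec_def)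
qed

text \<open>If \<open>u\<close> is the first column of \<open>U\<close>, then the block matrix
  diag(1, U) sends (k, 1, 0, ..., 0) to (k, u), and the former vector is a column of a product of
  elementary matrices.\<close>

lemma primitive_vec_vCons:
  assumes "primitive_vec l u" "l > 0"
  shows "primitive_vec (Suc l) (vCons k u)"
proof -
  obtain U where U: "unimodular l U" "col U 0 = u"
    using assms(1) by (auto simp: primitive_vec_def)
  define V where "V = four_block_mat (1\<^sub>m 1) (0\<^sub>m 1 l) (0\<^sub>m l 1) U"
  have Uc: "U \<in> carrier_mat l l" using U by (simp add: unimodular_def)
  have "det V = det U"
    unfolding V_def using Uc by (subst det_four_block_mat_upper_right_zero[of _ 1 _ l]) auto
  then have V: "unimodular (Suc l) V"
    using U Uc by (auto simp: unimodular_def V_def)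
  \<comment> \<open>Column 0 of \<open>S\<close> is the second unit vector; adding \<open>k\<close>
    times row 1 to row 0 puts \<open>k\<close> on top of it.\<close>
  define S where "S = swapcols 0 1 (1\<^sub>m (Suc l) :: int mat)"
  have S: "S \<in> carrier_mat (Suc l) (Suc l)" by (simp add: S_def)
  have "det S = - 1"
    unfolding S_def using assms(2) by (subst det_swapcols[of _ "Suc l"]) auto
  then have "det (addrow k 0 1 S) = - 1"
    using det_addrow[of 1 "Suc l" 0 S k] assms(2) S by simp
  then have W: "unimodular (Suc l) (addrow k 0 1 S)"
    using S by (simp add: unimodular_def)
  have "col (addrow k 0 1 S) 0 = vec (Suc l) (\<lambda>i. if i = 0 then k else if i = 1 then 1 else 0)"
    using assms(2) by (auto intro!: eq_vecI simp: S_def)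
  then have "primitive_vec (Suc l) (vec (Suc l) (\<lambda>i. if i = 0 then k else if i = 1 then 1 else 0))"
    using W by (auto simp: primitive_vec_def)
  then have "primitive_vec (Suc l) (V *\<^sub>v vec (Suc l) (\<lambda>i. if i = 0 then k else if i = 1 then 1 else 0))"
    by (intro primitive_vec_image V) auto
  moreover have "V *\<^sub>v vec (Suc l) (\<lambda>i. if i = 0 then k else if i = 1 then 1 else 0) = vCons k u"
  proof (rule eq_vecI)
    fix i assume "i < dim_vec (vCons k u)"
    then have i: "i < Suc l" using U Uc by auto
    have "(V *\<^sub>v vec (Suc l) (\<lambda>i. if i = 0 then k else if i = 1 then 1 else 0)) $ i
      = (\<Sum>j = 0..<Suc l. V $$ (i, j) * (if j = 0 then k else if j = 1 then 1 else 0))"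
      using i Uc by (simp add: V_def scalar_prod_def del: sum.op_ivl_Suc)
    also have "\<dots> = V $$ (i, 0) * k + V $$ (i, 1)"
    proof -
      obtain l' where l': "l = Suc l'" using assms(2) by (cases l) auto
      show ?thesis unfolding l'
        by (simp add: sum.atLeast0_lessThan_Suc_shift del: sum.op_ivl_Suc)
    qed
    also have "\<dots> = vCons k u $ i"
      using i Uc U(2) assms(2) by (cases i) (auto simp: V_def)
    finally show "(V *\<^sub>v vec (Suc l) (\<lambda>i. if i = 0 then k else if i = 1 then 1 else 0)) $ i = vCons k u $ i" .
  qed (use U Uc in \<open>auto simp: V_def\<close>)
  ultimately show ?thesis by simp
qed

lemma primitive_vec_carrier: "primitive_vec n x \<Longrightarrow> x \<in> carrier_vec n"
  by (auto simp: primitive_vec_def unimodular_def)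

lemma quad_form_congruence:
  assumes "G \<in> carrier_mat n n" "U \<in> carrier_mat n n" "x \<in> carrier_vec n"
  shows "quad_form (U\<^sup>T * G * U) x = quad_form G (U *\<^sub>v x)"
proof -
  have "(U\<^sup>T * G * U) *\<^sub>v x = U\<^sup>T *\<^sub>v (G *\<^sub>v (U *\<^sub>v x))"
    using assms by (simp add: assoc_mult_mat_vec[of _ n n _ n])
  moreover have "x \<bullet> (U\<^sup>T *\<^sub>v y) = (U *\<^sub>v x) \<bullet> y" if "y \<in> carrier_vec n" for y
    using transpose_vec_mult_scalar[of "U\<^sup>T" n n y x] that assms by simp
  ultimately show ?thesis using assms by (simp add: quad_form_def)
qed

lemma unimodular_mult_vec_nonzero:
  assumes "unimodular n U" "x \<in> carrier_vec n" "x \<noteq> 0\<^sub>v n"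
  shows "U *\<^sub>v x \<noteq> 0\<^sub>v n"
  using det_0_iff_vec_prod_zero[of U n] assms by (auto simp: unimodular_def)

lemma int_positive_definite_congruence:
  assumes "int_positive_definite n G" "unimodular n U"
  shows "int_positive_definite n (U\<^sup>T * G * U)"
proof -
  have c: "G \<in> carrier_mat n n" "U \<in> carrier_mat n n" "G\<^sup>T = G"
    using assms by (auto simp: int_positive_definite_def unimodular_def)
  have "(U\<^sup>T * G * U)\<^sup>T = U\<^sup>T * (G\<^sup>T * U)"
    using c by (simp add: transpose_mult[of _ n n _ n])
  also have "\<dots> = U\<^sup>T * G * U" using c by (simp add: assoc_mult_mat[of _ n n _ n _ n])
  finally have "(U\<^sup>T * G * U)\<^sup>T = U\<^sup>T * G * U" .
  moreover have "quad_form (U\<^sup>T * G * U) x > 0" if "x \<in> carrier_vec n" "x \<noteq> 0\<^sub>v n" for x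
    unfolding quad_form_congruence[OF c(1,2) that(1)]
    using assms(1) c that unimodular_mult_vec_nonzero[OF assms(2) that]
    by (auto simp: int_positive_definite_def)
  ultimately show ?thesis
    using c by (simp add: int_positive_definite_def)
qed

lemma det_congruence:
  assumes "G \<in> carrier_mat n n" "unimodular n U"
  shows "det (U\<^sup>T * G * U) = det G"
proof -
  have c: "U \<in> carrier_mat n n" "det U * det U = 1" using assms by (auto simp: unimodular_def)
  then have "det (U\<^sup>T * G * U) = det U * det G * det U"
    using assms(1) by (simp add: det_mult[of _ n] det_transpose[of _ n])
  then show ?thesis using c(2) by (metis mult.assoc mult.commute mult_1)
qed

section \<open>Hermite's inequality and the rank of even unimodular forms\<close>

text \<open>Every \<open>y\<close>, once scaled by the pivot, lifts to an integral vector on which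
  the square in the second claim vanishes, so positivity passes from \<open>G\<close> to
  \<open>H\<close>.\<close>

lemma int_positive_definite_schur:
  assumes "int_positive_definite (Suc l) G"
  defines "H \<equiv> mat l l (\<lambda>(i, j). G $$ (0, 0) * G $$ (Suc i, Suc j)
    - G $$ (Suc i, 0) * G $$ (0, Suc j))"
  shows "int_positive_definite l H"
    and "\<And>x. x \<in> carrier_vec (Suc l) \<Longrightarrow> G $$ (0, 0) * quad_form G x
      = (\<Sum>j<Suc l. G $$ (0, j) * x $ j)\<^sup>2
       + quad_form H (vec l (\<lambda>i. x $ Suc i))"
    and "G $$ (0, 0) > 0"
proof -
  have c: "G \<in> carrier_mat (Suc l) (Suc l)" and t: "G\<^sup>T = G"
    and pos: "\<And>x. x \<in> carrier_vec (Suc l) \<Longrightarrow> x \<noteq> 0\<^sub>v (Suc l) \<Longrightarrow> quad_form G x > 0"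
    using assms by (auto simp: int_positive_definite_def)
  have sym: "G $$ (i, j) = G $$ (j, i)" if "i < Suc l" "j < Suc l" for i j
    using arg_cong[OF t, of "\<lambda>M. M $$ (i, j)"] that c by simp
  show sq: "G $$ (0, 0) * quad_form G x = (\<Sum>j<Suc l. G $$ (0, j) * x $ j)\<^sup>2
       + quad_form H (vec l (\<lambda>i. x $ Suc i))" if "x \<in> carrier_vec (Suc l)" for x
    unfolding H_def using complete_square[of l "\<lambda>i j. G $$ (i, j)" "\<lambda>i. x $ i"] sym that
    by (simp add: quad_form_sum[OF c] quad_form_sum[of _ l] del: sum.lessThan_Suc)
  show m: "G $$ (0, 0) > 0"
    using pos[of "unit_vec (Suc l) 0"] c
    by (auto simp: quad_form_def scalar_prod_left_unit[of _ "Suc l"])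
  have "quad_form H y > 0" if y: "y \<in> carrier_vec l" "y \<noteq> 0\<^sub>v l" for y
  proof -
    define s where "s = (\<Sum>j<l. G $$ (0, Suc j) * y $ j)"
    define x where "x = vCons (- s) (G $$ (0, 0) \<cdot>\<^sub>v y)"
    have xc: "x \<in> carrier_vec (Suc l)" using y by (simp add: x_def)
    obtain i where "i < l" "y $ i \<noteq> 0"
      using y by (metis carrier_vecD eq_vecI index_zero_vec)
    then have "x $ Suc i \<noteq> 0" using y m by (simp add: x_def)
    then have "x \<noteq> 0\<^sub>v (Suc l)" using \<open>i < l\<close> by auto
    then have "0 < G $$ (0, 0) * quad_form G x" using pos xc m by simp
    also have "\<dots> = (\<Sum>j<Suc l. G $$ (0, j) * x $ j)\<^sup>2 + quad_form H (vec l (\<lambda>i. x $ Suc i))"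
      by (rule sq[OF xc])
    also have "(\<Sum>j<Suc l. G $$ (0, j) * x $ j) = 0"
      unfolding sum.lessThan_Suc_shift using y
      by (simp add: x_def s_def sum_distrib_left mult_ac)
    also have "vec l (\<lambda>i. x $ Suc i) = G $$ (0, 0) \<cdot>\<^sub>v y"
      using y by (auto simp: x_def intro!: eq_vecI)
    also have "quad_form H (G $$ (0, 0) \<cdot>\<^sub>v y) = (G $$ (0, 0))\<^sup>2 * quad_form H y"
      using y unfolding H_def by (simp add: quad_form_sum[of _ l] sum_distrib_left power2_eq_square mult_ac)
    finally show ?thesis by (simp add: zero_less_mult_iff)
  qed
  then show "int_positive_definite l H"
    using sym by (auto simp: int_positive_definite_def H_def intro!: eq_matI)
qed

text \<open>Induction by projection along a minimal primitive vector of value \<open>m\<close>. A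
  primitive \<open>u\<close> with small value under the projected form \<open>H\<close> lifts to a
  primitive \<open>y\<close> whose component along the minimal vector is at most one half, so
  minimality gives \<open>3 * (m * m) \<le> 4 * quad_form H u\<close>. Repetition collects 4/3 with
  exponent 1 + 2 + ... + l, written without fractions to stay in the integers.\<close>

lemma hermite_bound:
  assumes "int_positive_definite (Suc l) G"
  shows "\<exists>x. primitive_vec (Suc l) x \<and> quad_form G x > 0 \<and>
    3 ^ (Suc l * l div 2) * quad_form G x ^ Suc l \<le> 4 ^ (Suc l * l div 2) * det G"
  using assms
proof (induction l arbitrary: G)
  case 0
  have c: "G \<in> carrier_mat 1 1" using 0 by (simp add: int_positive_definite_def)
  have "primitive_vec 1 (unit_vec 1 0)"
    unfolding primitive_vec_def by (intro exI[of _ "1\<^sub>m 1"]) (simp add: unimodular_one)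
  moreover have "quad_form G (unit_vec 1 0) = G $$ (0, 0)"
    using c by (simp add: quad_form_def scalar_prod_left_unit[of _ 1])
  ultimately show ?case
    using int_positive_definite_schur(3)[OF 0] c det_single[OF c]
    by (intro exI[of _ "unit_vec 1 0"]) simp
next
  case (Suc k)
  define l where "l = Suc k"
  have pd: "int_positive_definite (Suc l) G" using Suc.prems by (simp add: l_def)
  have c: "G \<in> carrier_mat (Suc l) (Suc l)" using pd by (simp add: int_positive_definite_def)
  have "primitive_vec (Suc l) (col (1\<^sub>m (Suc l)) 0)"
    unfolding primitive_vec_def using unimodular_one by blast
  \<comment> \<open>The minimum is taken over primitive vectors, not over all nonzero ones, so the
    minimiser extends to a basis by definition; \<open>nat\<close> supplies
    well-foundedness.\<close>
  then obtain x where x: "primitive_vec (Suc l) x"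
    and min: "\<And>y. primitive_vec (Suc l) y \<Longrightarrow> nat (quad_form G x) \<le> nat (quad_form G y)"
    using ex_has_least_nat[of "primitive_vec (Suc l)" _ "\<lambda>y. nat (quad_form G y)"] by metis
  obtain U where U: "unimodular (Suc l) U" "col U 0 = x"
    using x by (auto simp: primitive_vec_def)
  have Uc: "U \<in> carrier_mat (Suc l) (Suc l)" using U by (simp add: unimodular_def)
  define G1 where "G1 = U\<^sup>T * G * U"
  have pd1: "int_positive_definite (Suc l) G1"
    unfolding G1_def by (rule int_positive_definite_congruence[OF pd U(1)])
  define m where "m = G1 $$ (0, 0)"
  have G1c: "G1 \<in> carrier_mat (Suc l) (Suc l)" using pd1 by (simp add: int_positive_definite_def)
  have Ue: "U *\<^sub>v unit_vec (Suc l) 0 = x"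
    using Uc U(2) by (auto intro!: eq_vecI simp: scalar_prod_right_unit[of _ "Suc l"])
  have m_eq: "quad_form G x = m"
  proof -
    have "quad_form G1 (unit_vec (Suc l) 0) = quad_form G x"
      unfolding G1_def Ue[symmetric] by (rule quad_form_congruence[OF c Uc]) simp
    moreover have "quad_form G1 (unit_vec (Suc l) 0) = m"
      using G1c by (simp add: quad_form_def m_def scalar_prod_left_unit[of _ "Suc l"])
    ultimately show ?thesis by simp
  qed
  define H where "H = mat l l (\<lambda>(i, j). G1 $$ (0, 0) * G1 $$ (Suc i, Suc j)
    - G1 $$ (Suc i, 0) * G1 $$ (0, Suc j))"
  note schur = int_positive_definite_schur[OF pd1, folded H_def, folded m_def]
  have m: "m > 0" by (rule schur(3))
  obtain u where u: "primitive_vec l u" "quad_form H u > 0"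
    "3 ^ (Suc k * k div 2) * quad_form H u ^ l \<le> 4 ^ (Suc k * k div 2) * det H"
    using Suc.IH[of H] schur(1) unfolding l_def by blast
  define s where "s = (\<Sum>j<l. G1 $$ (0, Suc j) * u $ j)"
  \<comment> \<open>Minus the integer nearest to \<open>s / m\<close>, so that
    \<open>m * z + s\<close> is at most \<open>m / 2\<close> in absolute value.\<close>
  define z where "z = - ((2 * s + m) div (2 * m))"
  have z: "(2 * (m * z + s))\<^sup>2 \<le> m\<^sup>2"
  proof -
    have "2 * (m * z + s) + m = (2 * s + m) mod (2 * m)"
      unfolding z_def by (simp add: minus_div_mult_eq_mod [symmetric] algebra_simps)
    moreover have "0 \<le> (2 * s + m) mod (2 * m)" "(2 * s + m) mod (2 * m) < 2 * m"
      using m by simp_all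
    ultimately have "\<bar>2 * (m * z + s)\<bar> \<le> \<bar>m\<bar>" using m by linarith
    then show ?thesis by (rule abs_le_square_iff[THEN iffD1])
  qed
  define y where "y = vCons z u"
  have uc: "u \<in> carrier_vec l" using u(1) by (rule primitive_vec_carrier)
  have yp: "primitive_vec (Suc l) y"
    unfolding y_def using u(1) by (intro primitive_vec_vCons) (auto simp: l_def)
  have yc: "y \<in> carrier_vec (Suc l)" using yp by (rule primitive_vec_carrier)
  have "m \<le> quad_form G1 y"
  proof -
    have "nat (quad_form G x) \<le> nat (quad_form G (U *\<^sub>v y))"
      by (intro min primitive_vec_image U yp) simp
    then have "nat m \<le> nat (quad_form G1 y)"
      unfolding G1_def quad_form_congruence[OF c Uc yc] m_eq .
    then show ?thesis using m by simp
  qed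
  then have "4 * m * m \<le> 4 * m * quad_form G1 y" using m by simp
  also have "\<dots> = 4 * (m * quad_form G1 y)" by simp
  also have "m * quad_form G1 y = (\<Sum>j<Suc l. G1 $$ (0, j) * y $ j)\<^sup>2 + quad_form H (vec l (\<lambda>i. y $ Suc i))"
    by (rule schur(2)[OF yc])
  also have "(\<Sum>j<Suc l. G1 $$ (0, j) * y $ j) = m * z + s"
    unfolding sum.lessThan_Suc_shift by (simp add: y_def s_def m_def)
  also have "vec l (\<lambda>i. y $ Suc i) = u"
    using uc by (auto simp: y_def intro!: eq_vecI)
  also have "4 * ((m * z + s)\<^sup>2 + quad_form H u) = (2 * (m * z + s))\<^sup>2 + 4 * quad_form H u"
    by (simp add: power2_eq_square algebra_simps)
  also have "\<dots> \<le> m * m + 4 * quad_form H u" using z by (simp add: power2_eq_square)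
  finally have m2: "3 * (m * m) \<le> 4 * quad_form H u" by simp
  have det: "m ^ l * det G = m * det H"
  proof -
    have "mat (Suc l) (Suc l) (\<lambda>(i, j). G1 $$ (i, j)) = G1"
      using G1c by (auto intro!: eq_matI)
    then have "m ^ l * det G1 = m * det H"
      using det_schur_1[of "\<lambda>i j. G1 $$ (i, j)" l] by (simp add: m_def H_def)
    then show ?thesis using det_congruence[OF c U(1)] by (simp add: G1_def)
  qed
  define a where "a = Suc k * k div 2"
  have b: "Suc l * l div 2 = a + l"
  proof -
    have "Suc l * l = Suc k * k + l * 2" by (simp add: l_def algebra_simps)
    then show ?thesis unfolding a_def by simp
  qed
  \<comment> \<open>The extra factor \<open>m ^ l\<close> is carried along until
    \<open>m ^ l * det G = m * det H\<close> can remove \<open>det H\<close>; it is cancelled at the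
    end.\<close>
  have "3 ^ (a + l) * m ^ Suc l * m ^ l = m * (3 ^ a * (3 * (m * m)) ^ l)"
    by (simp add: power_add power_mult_distrib algebra_simps)
  also have "\<dots> \<le> m * (3 ^ a * (4 * quad_form H u) ^ l)"
    using m2 m by (intro mult_left_mono power_mono) auto
  also have "\<dots> = 4 ^ l * m * (3 ^ a * quad_form H u ^ l)"
    by (simp add: power_mult_distrib algebra_simps)
  also have "\<dots> \<le> 4 ^ l * m * (4 ^ a * det H)"
    using u(3) m unfolding a_def by (intro mult_left_mono) auto
  also have "\<dots> = 4 ^ (a + l) * (m * det H)" by (simp add: power_add)
  also have "\<dots> = 4 ^ (a + l) * det G * m ^ l" unfolding det[symmetric] by simp
  finally have "3 ^ (a + l) * m ^ Suc l \<le> 4 ^ (a + l) * det G"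
    using m by simp
  then show ?case
    using x m unfolding l_def[symmetric] b by (intro exI[of _ x]) (simp add: m_eq)
qed

theorem even_unimodular_rank_ge_8:
  assumes pd: "int_positive_definite n G" and "n > 0"
    and ev: "\<And>i. i < n \<Longrightarrow> even (G $$ (i, i))" and det: "det G * det G = 1"
  shows "n \<ge> 8"
proof (rule ccontr)
  assume "\<not> n \<ge> 8"
  have c: "G \<in> carrier_mat n n" and t: "G\<^sup>T = G"
    using pd by (auto simp: int_positive_definite_def)
  have sym: "G $$ (i, j) = G $$ (j, i)" if "i < n" "j < n" for i j
    using arg_cong[OF t, of "\<lambda>M. M $$ (i, j)"] that c by simp
  obtain l where l: "n = Suc l" using \<open>n > 0\<close> by (cases n) auto
  obtain x where x: "primitive_vec n x" "quad_form G x > 0"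
    "3 ^ (n * l div 2) * quad_form G x ^ n \<le> 4 ^ (n * l div 2) * det G"
    using hermite_bound[of l G] pd unfolding l by blast
  have "0 < 3 ^ (n * l div 2) * quad_form G x ^ n" using x by simp
  also note x(3)
  finally have "det G > 0" by (simp add: zero_less_mult_iff)
  with det have d: "det G = 1" by (auto simp: zmult_eq_1_iff)
  have G: "mat n n (\<lambda>(i, j). G $$ (i, j)) = G" using c by (auto intro!: eq_matI)
  have "even n \<and> [det G = (- 1) ^ (n div 2)] (mod 4)"
    using even_symmetric_det_mod_4[of n "\<lambda>i j. G $$ (i, j)"] sym ev d unfolding G by simp
  \<comment> \<open>In ranks 2 and 6 the sign \<open>(- 1) ^ (n div 2)\<close> would be - 1, which
    differs from 1 modulo 4.\<close>
  then have "even n" "even (n div 2)"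
    unfolding d by (auto simp: cong_def elim: oddE) (cases "even (n div 2)"; simp)
  with \<open>\<not> n \<ge> 8\<close> \<open>n > 0\<close> have n: "n = 4" by presburger
  have "even (quad_form G x)"
    unfolding quad_form_sum[OF c primitive_vec_carrier[OF x(1)]]
    by (rule even_sum_symmetric) (auto simp: sym ev)
  with x(2) have "2 \<le> quad_form G x" by presburger
  then have "2 ^ 4 \<le> quad_form G x ^ 4" by (intro power_mono) auto
  \<comment> \<open>The exponent is 6 in rank 4, and 3^6 * 2^4 = 11664 exceeds 4^6 = 4096.\<close>
  with x(3) n l d show False by simp
qed

section \<open>Lattices with cyclic discriminant group\<close>

lemma independent_list_coeffs_zero:
  fixes c :: "nat \<Rightarrow> real"
  assumes "distinct bs" "independent (set bs)" "(\<Sum>i<length bs. c i *\<^sub>R bs ! i) = 0" "k < length bs"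
  shows "c k = 0"
proof -
  have bij: "bij_betw (\<lambda>i. bs ! i) {..<length bs} (set bs)"
    by (rule bij_betw_nth[OF assms(1)]) auto
  define u where "u v = c (the_inv_into {..<length bs} (\<lambda>i. bs ! i) v)" for v
  have u: "u (bs ! i) = c i" if "i < length bs" for i
    using that bij unfolding u_def bij_betw_def by (simp add: the_inv_into_f_f)
  have "(\<Sum>v\<in>set bs. u v *\<^sub>R v) = (\<Sum>i<length bs. u (bs ! i) *\<^sub>R bs ! i)"
    by (rule sum.reindex_bij_betw[OF bij, symmetric])
  also have "\<dots> = 0" using assms(3) u by simp
  finally have "u (bs ! k) = 0"
    using assms(2,4) by (metis List.finite_set independentD nth_mem subset_refl)
  then show ?thesis using u assms(4) by simp
qed

text \<open>\<open>B\<close> is unconstrained outside \<open>span L\<close>, so the algebraic rules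
  for it carry membership in the span.\<close>

locale lattice_space =
  fixes L :: "'v::real_vector set" and B :: "'v \<Rightarrow> 'v \<Rightarrow> real"
  assumes is_lattice: "is_lattice L B"
begin

lemma form_sym: "x \<in> span L \<Longrightarrow> y \<in> span L \<Longrightarrow> B x y = B y x"
  using is_lattice unfolding is_lattice_def by blast

lemma form_add_left:
  "x \<in> span L \<Longrightarrow> y \<in> span L \<Longrightarrow> z \<in> span L \<Longrightarrow> B (x + y) z = B x z + B y z"
  using is_lattice unfolding is_lattice_def by blast

lemma form_scale_left: "x \<in> span L \<Longrightarrow> y \<in> span L \<Longrightarrow> B (c *\<^sub>R x) y = c * B x y"
  using is_lattice unfolding is_lattice_def by blast

lemma form_add_right:
  "x \<in> span L \<Longrightarrow> y \<in> span L \<Longrightarrow> z \<in> span L \<Longrightarrow> B z (x + y) = B z x + B z y"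
  using form_add_left form_sym by (metis span_add)

lemma form_scale_right: "x \<in> span L \<Longrightarrow> y \<in> span L \<Longrightarrow> B y (c *\<^sub>R x) = c * B y x"
  using form_scale_left form_sym by (metis span_scale)

lemma form_zero_left: "y \<in> span L \<Longrightarrow> B 0 y = 0"
  using form_scale_left[of 0 y 0] by (simp add: span_zero)

lemma form_sum_left:
  assumes "\<And>i. i \<in> A \<Longrightarrow> f i \<in> span L" "y \<in> span L"
  shows "B (\<Sum>i\<in>A. f i) y = (\<Sum>i\<in>A. B (f i) y)"
  using assms
  by (induction A rule: infinite_finite_induct) (auto simp: form_zero_left form_add_left span_sum)

lemma form_sum_right:
  assumes "\<And>i. i \<in> A \<Longrightarrow> f i \<in> span L" "y \<in> span L"
  shows "B y (\<Sum>i\<in>A. f i) = (\<Sum>i\<in>A. B y (f i))"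
proof -
  have "B y (\<Sum>i\<in>A. f i) = B (\<Sum>i\<in>A. f i) y"
    using assms by (intro form_sym span_sum) auto
  also have "\<dots> = (\<Sum>i\<in>A. B (f i) y)"
    using assms by (rule form_sum_left)
  also have "\<dots> = (\<Sum>i\<in>A. B y (f i))"
    using assms by (intro sum.cong form_sym) auto
  finally show ?thesis .
qed

lemma lattice_coords:
  assumes "lattice_basis L bs"
  shows "v \<in> L \<longleftrightarrow> (\<exists>c :: nat \<Rightarrow> int. v = (\<Sum>i<length bs. of_int (c i) *\<^sub>R bs ! i))"
  using assms by (auto simp: lattice_basis_def)

lemma basis_in_lattice:
  assumes "lattice_basis L bs" "k < length bs"
  shows "bs ! k \<in> L"
proof -
  have "(\<Sum>i<length bs. of_int (if i = k then 1 else 0) *\<^sub>R bs ! i)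
      = (\<Sum>i<length bs. if i = k then bs ! i else 0)"
    by (intro sum.cong) auto
  also have "\<dots> = bs ! k" using assms(2) by simp
  finally show ?thesis unfolding lattice_coords[OF assms(1)] by metis
qed

lemma basis_exists: "\<exists>bs. lattice_basis L bs"
  using is_lattice by (auto simp: is_lattice_def)

lemma lattice_zero: "0 \<in> L"
proof -
  obtain bs where bs: "lattice_basis L bs" using basis_exists by blast
  show ?thesis unfolding lattice_coords[OF bs] by (rule exI[of _ "\<lambda>_. 0"]) simp
qed

lemma lattice_add: "x \<in> L \<Longrightarrow> y \<in> L \<Longrightarrow> x + y \<in> L"
proof -
  obtain bs where bs: "lattice_basis L bs" using basis_exists by blast
  assume "x \<in> L" "y \<in> L"
  then obtain c d :: "nat \<Rightarrow> int" where "x = (\<Sum>i<length bs. of_int (c i) *\<^sub>R bs ! i)"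
    "y = (\<Sum>i<length bs. of_int (d i) *\<^sub>R bs ! i)"
    unfolding lattice_coords[OF bs] by blast
  then have "x + y = (\<Sum>i<length bs. of_int (c i + d i) *\<^sub>R bs ! i)"
    by (simp add: sum.distrib scaleR_add_left)
  then show "x + y \<in> L" unfolding lattice_coords[OF bs] by (intro exI[of _ "\<lambda>i. c i + d i"])
qed

lemma lattice_scale: "x \<in> L \<Longrightarrow> of_int k *\<^sub>R x \<in> L"
proof -
  obtain bs where bs: "lattice_basis L bs" using basis_exists by blast
  assume "x \<in> L"
  then obtain c :: "nat \<Rightarrow> int" where "x = (\<Sum>i<length bs. of_int (c i) *\<^sub>R bs ! i)"
    unfolding lattice_coords[OF bs] by blast
  then have "of_int k *\<^sub>R x = (\<Sum>i<length bs. of_int (k * c i) *\<^sub>R bs ! i)"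
    by (simp add: scaleR_sum_right)
  then show "of_int k *\<^sub>R x \<in> L" unfolding lattice_coords[OF bs] by (intro exI[of _ "\<lambda>i. k * c i"])
qed

lemma lattice_minus: "x \<in> L \<Longrightarrow> - x \<in> L"
  using lattice_scale[of x "- 1"] by simp

lemma lattice_diff: "x \<in> L \<Longrightarrow> y \<in> L \<Longrightarrow> x - y \<in> L"
  using lattice_add[of x "- y"] lattice_minus by simp

lemma dual_in_span: "v \<in> dual_lattice L B \<Longrightarrow> v \<in> span L"
  by (simp add: dual_lattice_def)

lemma dual_zero: "0 \<in> dual_lattice L B"
  by (auto simp: dual_lattice_def span_zero form_zero_left span_base)

lemma dual_add: "u \<in> dual_lattice L B \<Longrightarrow> v \<in> dual_lattice L B \<Longrightarrow> u + v \<in> dual_lattice L B"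
  by (auto simp: dual_lattice_def span_add form_add_left span_base)

lemma dual_scale: "u \<in> dual_lattice L B \<Longrightarrow> of_int k *\<^sub>R u \<in> dual_lattice L B"
  by (auto simp: dual_lattice_def span_scale form_scale_left span_base)

definition lattice_coset :: "'v \<Rightarrow> 'v set" where
  "lattice_coset v = (\<lambda>l. l + v) ` L"

lemma carrier_discriminant_module:
  "carrier (discriminant_module L B) = lattice_coset ` dual_lattice L B"
  by (auto simp: discriminant_module_def FactGroup_def RCOSETS_def r_coset_def
      additive_group_def lattice_coset_def)

lemma lattice_coset_eq_iff: "lattice_coset u = lattice_coset v \<longleftrightarrow> u - v \<in> L"
proof
  assume "lattice_coset u = lattice_coset v"
  then have "u \<in> lattice_coset v" unfolding lattice_coset_def using lattice_zero by force
  then show "u - v \<in> L" by (auto simp: lattice_coset_def)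
next
  have *: "lattice_coset u \<subseteq> lattice_coset v" if "u - v \<in> L" for u v
  proof
    fix x assume "x \<in> lattice_coset u"
    then obtain l where "l \<in> L" "x = l + u" by (auto simp: lattice_coset_def)
    then have "x = (l + (u - v)) + v" "l + (u - v) \<in> L" using that by (auto intro: lattice_add)
    then show "x \<in> lattice_coset v" unfolding lattice_coset_def by blast
  qed
  assume "u - v \<in> L"
  moreover then have "v - u \<in> L" using lattice_minus by fastforce
  ultimately show "lattice_coset u = lattice_coset v" using * by blast
qed

lemma mult_discriminant_module:
  "lattice_coset u \<otimes>\<^bsub>discriminant_module L B\<^esub> lattice_coset v = lattice_coset (u + v)"
proof -
  have "lattice_coset u \<otimes>\<^bsub>discriminant_module L B\<^esub> lattice_coset v = {x + y | x y. x \<in> lattice_coset u \<and> y \<in> lattice_coset v}"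
    by (auto simp: discriminant_module_def FactGroup_def set_mult_def additive_group_def)
  also have "\<dots> = lattice_coset (u + v)"
  proof safe
    fix x y assume "x \<in> lattice_coset u" "y \<in> lattice_coset v"
    then obtain l m where "l \<in> L" "m \<in> L" "x = l + u" "y = m + v" by (auto simp: lattice_coset_def)
    then show "x + y \<in> lattice_coset (u + v)"
      unfolding lattice_coset_def by (intro image_eqI[of _ _ "l + m"]) (auto intro: lattice_add)
  next
    fix x assume "x \<in> lattice_coset (u + v)"
    then obtain l where "l \<in> L" "x = (l + u) + (0 + v)" by (auto simp: lattice_coset_def add.assoc)
    then show "\<exists>y z. x = y + z \<and> y \<in> lattice_coset u \<and> z \<in> lattice_coset v"
      unfolding lattice_coset_def using lattice_zero by blast
  qed
  finally show ?thesis .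
qed

end

lemma mod_Ints_eq_iff: "mod_Ints s = mod_Ints t \<longleftrightarrow> s - t \<in> \<int>"
proof
  assume "mod_Ints s = mod_Ints t"
  moreover have "s \<in> mod_Ints s" by (auto simp: mod_Ints_def intro: exI[of _ 0])
  ultimately show "s - t \<in> \<int>" by (auto simp: mod_Ints_def)
next
  assume "s - t \<in> \<int>"
  then obtain k :: int where k: "s = t + of_int k" by (auto elim!: Ints_cases simp: algebra_simps)
  have "s + of_int j = t + of_int (k + j)" "t + of_int j = s + of_int (j - k)" for j
    by (simp_all add: k)
  then show "mod_Ints s = mod_Ints t" unfolding mod_Ints_def by blast
qed

locale even_lattice_space = lattice_space +
  assumes even: "even_lattice L B"
begin

lemma lattice_in_dual: "v \<in> L \<Longrightarrow> v \<in> dual_lattice L B"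
  using even by (auto simp: dual_lattice_def even_lattice_def span_base)

lemma even_norm: "v \<in> L \<Longrightarrow> \<exists>k::int. B v v = 2 * of_int k"
  using even by (auto simp: even_lattice_def)

text \<open>Adding \<open>l\<close> from \<open>L\<close> changes the value by
  \<open>B l l / 2 + B v l\<close>; evenness makes the first term an integer and duality the second,
  so all sets in the defining union agree.\<close>

lemma qform_discriminant_module:
  assumes v: "v \<in> dual_lattice L B"
  shows "qform (discriminant_module L B) (lattice_coset v) = mod_Ints (B v v / 2)"
proof -
  have eq: "mod_Ints (B w w / 2) = mod_Ints (B v v / 2)" if w: "w \<in> lattice_coset v" for w
  proof -
    obtain l where l: "l \<in> L" "w = l + v" using w by (auto simp: lattice_coset_def)
    obtain k :: int where k: "B l l = 2 * of_int k" using even_norm l by blast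
    have "B v l \<in> \<int>" using v l by (auto simp: dual_lattice_def)
    moreover have "B w w / 2 - B v v / 2 = of_int k + B v l"
      using l v k form_sym[of l v] by (simp add: span_base dual_in_span form_add_left form_add_right span_add add_divide_distrib)
    ultimately show ?thesis unfolding mod_Ints_eq_iff by simp
  qed
  have "lattice_coset v \<noteq> {}" unfolding lattice_coset_def using lattice_zero by blast
  then have "(\<Union>w\<in>lattice_coset v. mod_Ints (B w w / 2)) = mod_Ints (B v v / 2)"
    by (rule SUP_eq_const) (rule eq)
  then show ?thesis by (simp add: discriminant_module_def Let_def)
qed

end

lemma even_lattice_spaceI: "even_lattice L B \<Longrightarrow> even_lattice_space L B"
  by (simp add: even_lattice_space_def lattice_space_def even_lattice_space_axioms_def even_lattice_def)

lemma carrier_cyclic_module: "p > 0 \<Longrightarrow> carrier (cyclic_module p r a) = {0..<int (p ^ r)}"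
  by (simp add: cyclic_module_def carrier_integer_mod_group)

lemma mult_cyclic_module: "x \<otimes>\<^bsub>cyclic_module p r a\<^esub> y = (x + y) mod int (p ^ r)"
  by (simp add: cyclic_module_def mult_integer_mod_group)

section \<open>The unimodular overlattice of a cyclic discriminant module\<close>

context lattice_space
begin

text \<open>A representative \<open>g\<close> of the preimage of 1 expresses cyclicity through
  vectors of the dual lattice, so that cosets can be left behind.\<close>

lemma cyclic_discriminant_generator:
  assumes f: "f \<in> iso (discriminant_module L B) (cyclic_module p r a)" and p: "p > 0"
  obtains g where "g \<in> dual_lattice L B"
    and "\<And>v. v \<in> dual_lattice L B \<Longrightarrow> \<exists>k::int. v - of_int k *\<^sub>R g \<in> L"
    and "\<And>k::nat. of_int (int k) *\<^sub>R g \<in> L \<longleftrightarrow> p ^ r dvd k"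
proof -
  define N where "N = p ^ r"
  have N: "N > 0" using p by (simp add: N_def)
  let ?D = "discriminant_module L B"
  have hom: "f (X \<otimes>\<^bsub>?D\<^esub> Y) = (f X + f Y) mod int N" if "X \<in> carrier ?D" "Y \<in> carrier ?D" for X Y
    using f that by (simp add: iso_def hom_def mult_cyclic_module N_def)
  have bij: "bij_betw f (carrier ?D) {0..<int N}"
    using f p by (simp add: iso_def carrier_cyclic_module N_def)
  have in_D: "lattice_coset v \<in> carrier ?D" if "v \<in> dual_lattice L B" for v
    using that by (simp add: carrier_discriminant_module)
  have f_range: "f (lattice_coset v) \<in> {0..<int N}" if "v \<in> dual_lattice L B" for v
    using bij in_D[OF that] by (metis bij_betwE)
  have f_add: "f (lattice_coset (u + v)) = (f (lattice_coset u) + f (lattice_coset v)) mod int N"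
    if "u \<in> dual_lattice L B" "v \<in> dual_lattice L B" for u v
    using hom[OF in_D in_D, OF that] by (simp add: mult_discriminant_module)
  have f_inj: "u - v \<in> L" if "u \<in> dual_lattice L B" "v \<in> dual_lattice L B"
    "f (lattice_coset u) = f (lattice_coset v)" for u v
    using bij in_D that unfolding bij_betw_def inj_on_def by (metis lattice_coset_eq_iff)
  have f0: "f (lattice_coset 0) = 0"
  proof -
    have "f (lattice_coset 0) = (f (lattice_coset 0) + f (lattice_coset 0)) mod int N"
      using f_add[OF dual_zero dual_zero] by simp
    moreover have "f (lattice_coset 0) \<in> {0..<int N}" by (rule f_range[OF dual_zero])
    ultimately show ?thesis by (smt (verit) atLeastLessThan_iff mod_pos_pos_trivial minus_mod_self2)
  qed
  \<comment> \<open>Reducing 1 modulo \<open>N\<close> also covers \<open>N = 1\<close>.\<close>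
  have "1 mod int N \<in> {0..<int N}" using N by simp
  then obtain g where g: "g \<in> dual_lattice L B" "f (lattice_coset g) = 1 mod int N"
    using bij unfolding bij_betw_def carrier_discriminant_module by (metis imageE)
  have fk: "f (lattice_coset (of_int (int k) *\<^sub>R g)) = int k mod int N" for k
  proof (induction k)
    case 0
    then show ?case by (simp add: f0)
  next
    case (Suc k)
    have "f (lattice_coset (of_int (int k) *\<^sub>R g + g)) = (int k mod int N + 1 mod int N) mod int N"
      using f_add[OF dual_scale[OF g(1)] g(1)] Suc g(2) by presburger
    then show ?case by (simp add: algebra_simps mod_simps)
  qed
  show ?thesis
  proof
    show "g \<in> dual_lattice L B" by fact
    show "\<exists>k::int. v - of_int k *\<^sub>R g \<in> L" if v: "v \<in> dual_lattice L B" for v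
    proof -
      define k where "k = nat (f (lattice_coset v))"
      have "int k mod int N = f (lattice_coset v)"
        using f_range[OF v] by (simp add: k_def)
      then have "v - of_int (int k) *\<^sub>R g \<in> L"
        using fk[of k] by (intro f_inj v dual_scale g) simp
      then show ?thesis by blast
    qed
    show "of_int (int k) *\<^sub>R g \<in> L \<longleftrightarrow> p ^ r dvd k" for k
    proof -
      have "of_int (int k) *\<^sub>R g \<in> L \<longleftrightarrow> lattice_coset (of_int (int k) *\<^sub>R g) = lattice_coset 0"
        by (simp add: lattice_coset_eq_iff)
      also have "\<dots> \<longleftrightarrow> int k mod int N = 0"
        using fk[of k] f0 f_inj[OF dual_scale[OF g(1), of "int k"] dual_zero] lattice_coset_eq_iff by metis
      also have "\<dots> \<longleftrightarrow> N dvd k" by (simp flip: of_nat_mod add: mod_eq_0_iff_dvd)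
      finally show ?thesis by (simp add: N_def)
    qed
  qed
qed

text \<open>Nondegeneracy in coordinates, by solving the Gram system with the adjugate. It supplies
  the dual vectors that invert a pairing matrix in the rank bound.\<close>

lemma form_solvable:
  assumes bs: "lattice_basis L bs" and det: "det (gram_matrix B bs) \<noteq> 0"
  obtains v where "v \<in> span L" "\<And>l. l < length bs \<Longrightarrow> B v (bs ! l) = t l"
proof -
  let ?n = "length bs" and ?G = "gram_matrix B bs"
  have G: "?G \<in> carrier_mat ?n ?n" by (simp add: gram_matrix_def)
  have sp: "bs ! i \<in> span L" if "i < ?n" for i
    using basis_in_lattice[OF bs that] by (rule span_base)
  define y where "y = (1 / det ?G) \<cdot>\<^sub>v (adj_mat ?G *\<^sub>v vec ?n t)"
  have A: "adj_mat ?G \<in> carrier_mat ?n ?n" "?G * adj_mat ?G = det ?G \<cdot>\<^sub>m 1\<^sub>m ?n"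
    using adj_mat[OF G] by auto
  have yc: "y \<in> carrier_vec ?n" using A by (simp add: y_def)
  have "?G *\<^sub>v y = (1 / det ?G) \<cdot>\<^sub>v (?G *\<^sub>v (adj_mat ?G *\<^sub>v vec ?n t))"
    unfolding y_def using G A by (intro mult_mat_vec) auto
  also have "?G *\<^sub>v (adj_mat ?G *\<^sub>v vec ?n t) = (det ?G \<cdot>\<^sub>m 1\<^sub>m ?n) *\<^sub>v vec ?n t"
    using G A by (metis assoc_mult_mat_vec vec_carrier)
  also have "(1 / det ?G) \<cdot>\<^sub>v ((det ?G \<cdot>\<^sub>m 1\<^sub>m ?n) *\<^sub>v vec ?n t) = vec ?n t"
    using det by (auto intro!: eq_vecI simp: smult_scalar_prod_distrib[of _ ?n])
  finally have Gy: "?G *\<^sub>v y = vec ?n t" .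
  define v where "v = (\<Sum>j<?n. (y $ j) *\<^sub>R bs ! j)"
  have "v \<in> span L" unfolding v_def by (intro span_sum span_scale sp) auto
  moreover have "B v (bs ! l) = t l" if l: "l < ?n" for l
  proof -
    have "B v (bs ! l) = (\<Sum>j<?n. y $ j * B (bs ! j) (bs ! l))"
      unfolding v_def using l by (subst form_sum_left) (auto simp: sp form_scale_left intro: span_scale)
    also have "\<dots> = (\<Sum>j<?n. B (bs ! l) (bs ! j) * y $ j)"
      using l by (intro sum.cong) (auto simp: sp form_sym)
    also have "\<dots> = (?G *\<^sub>v y) $ l"
      using l yc by (simp add: gram_matrix_def scalar_prod_def lessThan_atLeast0)
    finally show ?thesis using Gy l by simp
  qed
  ultimately show thesis by (rule that)
qed

end

lemma (in even_lattice_space) cyclic_discriminant_rank_ge_8: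
  assumes pd: "positive_definite L B"
    and iso: "isometrically_isomorphic (discriminant_module L B) (cyclic_module p r a)"
    and p: "prime p" "odd p" and r: "even r" "r > 0"
  shows "8 \<le> lattice_rank L"
proof -
  define N where "N = p ^ r"
  define q where "q = p ^ (r div 2)"
  have qq: "q * q = N" unfolding q_def N_def using r by (metis dvd_div_mult_self mult_2_right power_add even_two_times_div_two mult_2)
  have pos: "p > 0" "N > 0" "q > 0" using p by (auto simp: N_def q_def prime_gt_0_nat)
  have oddN: "odd N" using p by (simp add: N_def)
  obtain bs where bs: "lattice_basis L bs" and det: "det (gram_matrix B bs) \<noteq> 0"
    using is_lattice by (auto simp: is_lattice_def)
  define n where "n = length bs"
  define b where "b j = bs ! j" for j
  have bL: "b j \<in> L" if "j < n" for j
    using basis_in_lattice[OF bs] that by (simp add: b_def n_def)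
  have coords: "v \<in> L \<longleftrightarrow> (\<exists>c :: nat \<Rightarrow> int. v = (\<Sum>i<n. of_int (c i) *\<^sub>R b i))" for v
    using lattice_coords[OF bs] by (simp add: n_def b_def)
  have coordsI: "(\<Sum>i<n. of_int (c i) *\<^sub>R b i) \<in> L" for c :: "nat \<Rightarrow> int"
    unfolding coords by (rule exI, rule refl)
  obtain f where "f \<in> iso (discriminant_module L B) (cyclic_module p r a)"
    using iso by (auto simp: isometrically_isomorphic_def)
  then obtain g where g: "g \<in> dual_lattice L B"
    and gen: "\<And>v. v \<in> dual_lattice L B \<Longrightarrow> \<exists>k::int. v - of_int k *\<^sub>R g \<in> L"
    and ord: "\<And>k::nat. of_int (int k) *\<^sub>R g \<in> L \<longleftrightarrow> N dvd k"
    using cyclic_discriminant_generator[OF _ pos(1)] unfolding N_def by blast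

  obtain c :: "nat \<Rightarrow> int" where c: "of_int (int N) *\<^sub>R g = (\<Sum>j<n. of_int (c j) *\<^sub>R b j)"
    using ord[of N] unfolding coords by auto
  \<comment> \<open>Otherwise \<open>p ^ (r - 1)\<close> times \<open>g\<close> would lie in
    \<open>L\<close>, against the order \<open>p ^ r\<close> of \<open>g\<close> modulo
    \<open>L\<close>.\<close>
  have "\<exists>i<n. \<not> int p dvd c i"
  proof (rule ccontr)
    assume "\<not> ?thesis"
    then have dvd: "c j = int p * (c j div int p)" if "j < n" for j using that by simp
    define N' where "N' = p ^ (r - 1)"
    have NN': "N = p * N'" using r by (simp add: N_def N'_def flip: power_Suc)
    have "of_int (int p) *\<^sub>R (of_int (int N') *\<^sub>R g) = of_int (int N) *\<^sub>R g"
      by (simp add: NN')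
    also have "\<dots> = of_int (int p) *\<^sub>R (\<Sum>j<n. of_int (c j div int p) *\<^sub>R b j)"
      unfolding c scaleR_sum_right
    proof (intro sum.cong refl)
      fix j assume "j \<in> {..<n}"
      then have "real_of_int (c j) = real_of_int (int p) * real_of_int (c j div int p)"
        using dvd[of j] by (metis lessThan_iff of_int_mult)
      then show "real_of_int (c j) *\<^sub>R b j = real_of_int (int p) *\<^sub>R real_of_int (c j div int p) *\<^sub>R b j"
        by simp
    qed
    finally have "of_int (int N') *\<^sub>R g = (\<Sum>j<n. of_int (c j div int p) *\<^sub>R b j)"
      using pos(1) by (subst (asm) scaleR_cancel_left) auto
    then have "of_int (int N') *\<^sub>R g \<in> L" by (simp only: coordsI)
    then have "N dvd N'" using ord by blast
    moreover have "N' > 0" using pos by (simp add: N'_def)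
    ultimately have "p * N' \<le> N'" using NN' by (metis dvd_imp_le)
    then show False using \<open>N' > 0\<close> prime_gt_1_nat[OF p(1)] by simp
  qed
  then obtain i where i: "i < n" "\<not> int p dvd c i" by blast
  have "coprime (c i) (int N)"
    using i(2) p(1) unfolding N_def
    by (simp add: coprime_commute prime_imp_coprime)
  then obtain k where "[c i * k = 1] (mod int N)" using cong_solve_coprime_int by blast
  then obtain t where t: "c i * k = 1 + int N * t"
    by (metis add.commute cong_iff_lin mult.commute cong_sym)

  \<comment> \<open>Coordinate \<open>i\<close> of \<open>N\<close> times \<open>h\<close> becomes
    \<open>c i * k - N * t = 1\<close>, so this vector can replace \<open>b i\<close> in the basis;
    \<open>d\<close> lists its coordinates.\<close>
  define h where "h = of_int k *\<^sub>R g - of_int t *\<^sub>R b i"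
  define d where "d j = (if j = i then 1 else k * c j)" for j
  have h: "h \<in> dual_lattice L B"
    unfolding h_def using dual_add[OF dual_scale[OF g, of k] dual_scale[OF lattice_in_dual[OF bL[OF i(1)]], of "- t"]] by simp
  \<comment> \<open>Modulo \<open>L\<close>, \<open>g\<close> agrees with \<open>c i\<close> times
    \<open>h\<close>, because \<open>N * t\<close> times \<open>g\<close> lies in
    \<open>L\<close>.\<close>
  have hgen: "\<exists>k::int. v - of_int k *\<^sub>R h \<in> L" if v: "v \<in> dual_lattice L B" for v
  proof -
    obtain j :: int where j: "v - of_int j *\<^sub>R g \<in> L" using gen[OF v] by blast
    have "of_int (- t) *\<^sub>R (of_int (int N) *\<^sub>R g) \<in> L"
      by (rule lattice_scale) (subst ord, rule dvd_refl)
    then have "g - of_int (c i * k) *\<^sub>R g \<in> L" unfolding t by (simp add: algebra_simps)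
    moreover have "of_int (c i * t) *\<^sub>R b i \<in> L" by (intro lattice_scale bL i)
    ultimately have "(g - of_int (c i * k) *\<^sub>R g) + of_int (c i * t) *\<^sub>R b i \<in> L" by (rule lattice_add)
    then have "of_int j *\<^sub>R ((g - of_int (c i * k) *\<^sub>R g) + of_int (c i * t) *\<^sub>R b i) \<in> L"
      by (rule lattice_scale)
    from lattice_add[OF j this]
    have "v - of_int (j * c i) *\<^sub>R h \<in> L" by (simp add: h_def algebra_simps)
    then show ?thesis by blast
  qed
  have Nh: "real N *\<^sub>R h = b i + (\<Sum>j\<in>{..<n}-{i}. of_int (d j) *\<^sub>R b j)"
  proof -
    have "real N *\<^sub>R h = of_int k *\<^sub>R (of_int (int N) *\<^sub>R g) - of_int (int N * t) *\<^sub>R b i"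
      by (simp add: h_def algebra_simps)
    also have "\<dots> = (\<Sum>j<n. of_int (c j * k) *\<^sub>R b j) - of_int (int N * t) *\<^sub>R b i"
      unfolding c scaleR_sum_right by (simp add: mult.commute)
    also have "\<dots> = of_int (c i * k) *\<^sub>R b i + (\<Sum>j\<in>{..<n}-{i}. of_int (c j * k) *\<^sub>R b j)
        - of_int (int N * t) *\<^sub>R b i"
      using i by (subst sum.remove[of _ i]) auto
    also have "\<dots> = b i + (\<Sum>j\<in>{..<n}-{i}. of_int (c j * k) *\<^sub>R b j)"
      unfolding t by (simp add: algebra_simps)
    also have "(\<Sum>j\<in>{..<n}-{i}. of_int (c j * k) *\<^sub>R b j) = (\<Sum>j\<in>{..<n}-{i}. of_int (d j) *\<^sub>R b j)"
      by (intro sum.cong) (auto simp: d_def mult.commute)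
    finally show ?thesis .
  qed
  have NhL: "real N *\<^sub>R h \<in> L"
  proof -
    have "real N *\<^sub>R h = (\<Sum>j<n. of_int (d j) *\<^sub>R b j)"
      unfolding Nh using i(1) by (subst sum.remove[of _ i]) (auto simp: d_def)
    then show ?thesis by (simp only: coordsI)
  qed
  have hs: "h \<in> span L" using h by (rule dual_in_span)
  have bsp: "b j \<in> span L" if "j < n" for j using bL[OF that] by (rule span_base)

  define e where "e j = (if j = i then real q *\<^sub>R h else b j)" for j
  \<comment> \<open>\<open>e\<close>, \<open>d'\<close> and \<open>f'\<close> are bases of the overlattice, of the dual lattice and of \<open>L\<close>.\<close>
  define d' where "d' j = (if j = i then h else b j)" for j
  define f' where "f' j = (if j = i then real N *\<^sub>R h else b j)" for j
  have es: "e j \<in> span L" if "j < n" for j using bsp[OF that] hs by (simp add: e_def span_scale)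
  have d's: "d' j \<in> dual_lattice L B" if "j < n" for j
    using lattice_in_dual[OF bL[OF that]] h by (simp add: d'_def)
  have f'L: "f' j \<in> L" if "j < n" for j using bL[OF that] NhL by (simp add: f'_def)
  have Bint: "B (d' j) (f' k) \<in> \<int>" if "j < n" "k < n" for j k
    using d's[OF that(1)] f'L[OF that(2)] by (auto simp: dual_lattice_def)
  \<comment> \<open>\<open>M\<close> pairs a basis of the dual lattice with a basis of
    \<open>L\<close>, so it is invertible over the integers, and \<open>E\<close> arises by moving a
    factor \<open>q\<close> between the arguments. The floors merely turn integral reals into
    \<open>int\<close>.\<close>
  define M where "M = mat n n (\<lambda>(j, k). \<lfloor>B (d' j) (f' k)\<rfloor>)"
  define E where "E = mat n n (\<lambda>(j, k). \<lfloor>B (e j) (e k)\<rfloor>)"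

  have Eint: "B (e j) (e k) \<in> \<int>" if "j < n" "k < n" for j k
  proof -
    have "B (b j) (b k) \<in> \<int>" using lattice_in_dual[OF bL[OF that(1)]] bL[OF that(2)]
      by (auto simp: dual_lattice_def)
    moreover have hb: "B h (b k) \<in> \<int>" "B h (b j) \<in> \<int>" "B h (real N *\<^sub>R h) \<in> \<int>"
      using h bL that NhL by (auto simp: dual_lattice_def)
    \<comment> \<open>By \<open>q * q = N\<close> the norm of \<open>q\<close> times
      \<open>h\<close> is a pairing of a dual vector with a vector of \<open>L\<close>.\<close>
    moreover have "B (real q *\<^sub>R h) (real q *\<^sub>R h) = B h (real N *\<^sub>R h)"
      using hs by (simp add: form_scale_left form_scale_right span_scale flip: qq)
    moreover have "B (b j) (real q *\<^sub>R h) = real q * B h (b j)"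
      using hs bsp[OF that(1)] form_sym[of h "b j"] by (simp add: form_scale_right)
    moreover have "B (real q *\<^sub>R h) (b k) = real q * B h (b k)"
      using hs bsp[OF that(2)] by (simp add: form_scale_left)
    ultimately show ?thesis by (auto simp: e_def)
  qed
  have Eev: "even (E $$ (j, j))" if j: "j < n" for j
  proof (cases "j = i")
    case True
    obtain u :: int where u: "B (real N *\<^sub>R h) (real N *\<^sub>R h) = 2 * of_int u"
      using even_norm[OF NhL] by blast
    \<comment> \<open>\<open>N\<close> times the norm of \<open>e i\<close> is the norm of a vector
      of \<open>L\<close>, hence even, and \<open>N\<close> is odd.\<close>
    have "B (real N *\<^sub>R h) (real N *\<^sub>R h) = real N * B (e j) (e j)"
      using hs True by (simp add: e_def form_scale_left form_scale_right span_scale flip: qq)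
    also have "B (e j) (e j) = of_int (E $$ (j, j))"
      using Eint[OF j j] j by (simp add: E_def)
    finally have "real_of_int (int N * E $$ (j, j)) = real_of_int (2 * u)" using u by simp
    then have "int N * E $$ (j, j) = 2 * u" by (simp only: of_int_eq_iff)
    then show ?thesis using oddN by (metis dvd_triv_left even_mult_iff even_of_nat)
  next
    case False
    obtain u :: int where "B (b j) (b j) = 2 * of_int u"
      using even_norm[OF bL[OF j]] by blast
    then have "B (e j) (e j) = of_int (2 * u)" using False by (simp add: e_def)
    then have "\<lfloor>B (e j) (e j)\<rfloor> = 2 * u" by (simp only: floor_of_int)
    then show ?thesis using j by (simp add: E_def)
  qed
  have Ereal: "real_of_int (E $$ (j, k)) = B (e j) (e k)" if "j < n" "k < n" for j k
    using Eint[OF that] that by (simp add: E_def)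
  have Mreal: "real_of_int (M $$ (j, k)) = B (d' j) (f' k)" if "j < n" "k < n" for j k
    using Bint[OF that] that by (simp add: M_def)
  have Ec: "E \<in> carrier_mat n n" and Mc: "M \<in> carrier_mat n n" by (auto simp: E_def M_def)

  have "int_positive_definite n E"
    unfolding int_positive_definite_def
  proof (intro conjI ballI impI)
    show "E\<^sup>T = E" using form_sym[OF es es] by (auto intro!: eq_matI simp: E_def)
    fix x :: "int vec" assume x: "x \<in> carrier_vec n" "x \<noteq> 0\<^sub>v n"
    define w where "w = (\<Sum>j<n. of_int (x $ j) *\<^sub>R e j)"
    have ws: "w \<in> span L" unfolding w_def by (intro span_sum span_scale es) auto
    have "B w w = (\<Sum>j<n. \<Sum>k<n. of_int (x $ j) * (of_int (x $ k) * B (e j) (e k)))"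
    proof -
      have "B w u = (\<Sum>j<n. of_int (x $ j) * B (e j) u)" if "u \<in> span L" for u
        unfolding w_def using that by (subst form_sum_left) (auto simp: es form_scale_left span_scale)
      from this[OF ws] have "B w w = (\<Sum>j<n. of_int (x $ j) * B (e j) w)" .
      also have "\<dots> = (\<Sum>j<n. of_int (x $ j) * (\<Sum>k<n. of_int (x $ k) * B (e j) (e k)))"
      proof (intro sum.cong refl arg_cong2[of _ _ _ _ "(*)"])
        fix j assume "j \<in> {..<n}"
        then show "B (e j) w = (\<Sum>k<n. of_int (x $ k) * B (e j) (e k))"
          unfolding w_def by (subst form_sum_right) (auto simp: es form_scale_right span_scale)
      qed
      finally show ?thesis by (simp add: sum_distrib_left)
    qed
    also have "\<dots> = (\<Sum>j<n. \<Sum>k<n. of_int (E $$ (j, k) * x $ j * x $ k))"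
      by (intro sum.cong) (auto simp: Ereal)
    also have "\<dots> = of_int (quad_form E x)"
      unfolding quad_form_sum[OF Ec x(1)] by simp
    finally have Bw: "B w w = of_int (quad_form E x)" .
    \<comment> \<open>Positivity is given only on \<open>L\<close>, and multiplication by
      \<open>q\<close> brings \<open>w\<close> into \<open>L\<close>. The coordinates
      \<open>y\<close> of \<open>z\<close> determine \<open>x\<close>, so \<open>z\<close> is
      nonzero.\<close>
    define z where "z = real q *\<^sub>R w"
    define y where "y j = (if j = i then x $ i else int q * x $ j + x $ i * d j)" for j
    have "z = (real q * of_int (x $ i)) *\<^sub>R e i + (\<Sum>j\<in>{..<n}-{i}. of_int (int q * x $ j) *\<^sub>R e j)"
      unfolding z_def w_def using i(1) by (subst sum.remove[of _ i]) (auto simp: scaleR_sum_right algebra_simps)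
    also have "(real q * of_int (x $ i)) *\<^sub>R e i = of_int (x $ i) *\<^sub>R (real N *\<^sub>R h)"
      by (simp add: e_def algebra_simps flip: qq)
    also have "(\<Sum>j\<in>{..<n}-{i}. of_int (int q * x $ j) *\<^sub>R e j) = (\<Sum>j\<in>{..<n}-{i}. of_int (int q * x $ j) *\<^sub>R b j)"
      by (intro sum.cong) (auto simp: e_def)
    also have "of_int (x $ i) *\<^sub>R (real N *\<^sub>R h) + (\<Sum>j\<in>{..<n}-{i}. of_int (int q * x $ j) *\<^sub>R b j)
        = of_int (x $ i) *\<^sub>R b i + (\<Sum>j\<in>{..<n}-{i}. of_int (int q * x $ j + x $ i * d j) *\<^sub>R b j)"
      unfolding Nh by (simp add: scaleR_sum_right sum.distrib scaleR_add_left algebra_simps)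
    also have "\<dots> = (\<Sum>j<n. of_int (y j) *\<^sub>R b j)"
      using i(1) by (subst (2) sum.remove[of _ i]) (auto simp: y_def intro!: sum.cong)
    finally have z: "z = (\<Sum>j<n. of_int (y j) *\<^sub>R b j)" .
    then have zL: "z \<in> L" by (simp only: coordsI)
    have "z \<noteq> 0"
    proof
      assume "z = 0"
      then have y0: "y j = 0" if "j < n" for j
        using independent_list_coeffs_zero[of bs "\<lambda>j. of_int (y j)" j] bs that z
        by (simp add: n_def b_def lattice_basis_def)
      have xi: "x $ i = 0" using y0[OF i(1)] by (simp add: y_def)
      have "x $ j = 0" if "j < n" for j
        using y0[OF that] xi pos by (cases "j = i") (auto simp: y_def)
      then show False using x by (auto intro!: eq_vecI)
    qed
    then have "B z z > 0" using pd zL by (auto simp: positive_definite_def)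
    moreover have "B z z = real q * (real q * B w w)"
      using ws by (simp add: z_def form_scale_left form_scale_right span_scale)
    ultimately show "quad_form E x > 0" using Bw pos by (simp add: zero_less_mult_iff)
  qed (rule Ec)
  moreover have "det E * det E = 1"
  proof -
    have "\<exists>Z :: nat \<Rightarrow> int. \<forall>l<n. (\<Sum>j<n. Z j * M $$ (j, l)) = (if m = l then 1 else 0)" if m: "m < n" for m
    proof -
      \<comment> \<open>Values on \<open>b\<close> that make \<open>v\<close> dual to
        \<open>f' m\<close>: for \<open>m\<close> other than \<open>i\<close>, the value
        \<open>- d m\<close> at \<open>b i\<close> cancels the contribution of \<open>b m\<close> to
        \<open>f' i\<close>.\<close>
      define \<tau> where "\<tau> l = (if m = i then (if l = i then 1 else 0) else if l = m then 1 else if l = i then - d m else 0)" for l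
      obtain v where v: "v \<in> span L" and vb: "\<And>l. l < n \<Longrightarrow> B v (b l) = of_int (\<tau> l)"
        using form_solvable[OF bs det, of "\<lambda>l. of_int (\<tau> l)"] unfolding n_def b_def by blast
      have "B v w \<in> \<int>" if w: "w \<in> L" for w
      proof -
        obtain c :: "nat \<Rightarrow> int" where "w = (\<Sum>i<n. of_int (c i) *\<^sub>R b i)" using w coords by blast
        then have "B v w = (\<Sum>i<n. of_int (c i) * B v (b i))"
          using v by (simp only:, subst form_sum_right)
            (auto simp: bsp form_scale_right span_scale)
        then have "B v w = of_int (\<Sum>i<n. c i * \<tau> i)" using vb by simp
        then show ?thesis by (simp only: Ints_of_int)
      qed
      then have vd: "v \<in> dual_lattice L B" using v by (simp add: dual_lattice_def)
      have vf: "B v (f' l) = (if m = l then 1 else 0)" if l: "l < n" for l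
      proof (cases "l = i")
        case True
        have "B v (f' l) = B v (b i) + (\<Sum>j\<in>{..<n}-{i}. of_int (d j) * B v (b j))"
        proof -
          have "B v (f' l) = B v (b i) + B v (\<Sum>j\<in>{..<n}-{i}. of_int (d j) *\<^sub>R b j)"
          proof -
            have "f' l = b i + (\<Sum>j\<in>{..<n}-{i}. of_int (d j) *\<^sub>R b j)"
              using True by (simp only: f'_def Nh simp_thms if_True)
            then show ?thesis
              using v bsp i(1) by (simp only:, intro form_add_right span_sum span_scale) auto
          qed
          also have "B v (\<Sum>j\<in>{..<n}-{i}. of_int (d j) *\<^sub>R b j) = (\<Sum>j\<in>{..<n}-{i}. of_int (d j) * B v (b j))"
            using v by (subst form_sum_right) (auto simp: bsp form_scale_right span_scale)
          finally show ?thesis .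
        qed
        also have "\<dots> = of_int (\<tau> i) + (\<Sum>j\<in>{..<n}-{i}. of_int (d j * \<tau> j))"
          using i(1) by (simp add: vb)
        also have "\<dots> = of_int (\<tau> i) + (\<Sum>j\<in>{..<n}-{i}. if j = m then of_int (d m) else 0)"
          by (intro arg_cong2[of _ _ _ _ "(+)"] sum.cong) (auto simp: \<tau>_def)
        also have "\<dots> = (if m = l then 1 else 0)"
          using m True by (simp add: \<tau>_def)
        finally show ?thesis .
      next
        case False
        then show ?thesis using vb[OF l] by (auto simp: f'_def \<tau>_def)
      qed
      \<comment> \<open>The dual lattice is generated by \<open>h\<close> and \<open>L\<close>, and
        \<open>b i\<close> is eliminated through \<open>N\<close> times \<open>h\<close>. The
        resulting coordinates \<open>Z\<close> form row \<open>m\<close> of the inverse of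
        \<open>M\<close>.\<close>
      obtain s :: int where "v - of_int s *\<^sub>R h \<in> L" using hgen[OF vd] by blast
      then obtain y :: "nat \<Rightarrow> int" where "v - of_int s *\<^sub>R h = (\<Sum>j<n. of_int (y j) *\<^sub>R b j)"
        using coords by blast
      then have "v = of_int s *\<^sub>R h + of_int (y i) *\<^sub>R b i + (\<Sum>j\<in>{..<n}-{i}. of_int (y j) *\<^sub>R b j)"
        using i(1) by (subst (asm) sum.remove[of _ i]) (auto simp: algebra_simps)
      also have "b i = real N *\<^sub>R h - (\<Sum>j\<in>{..<n}-{i}. of_int (d j) *\<^sub>R b j)"
        unfolding Nh by simp
      also have "of_int s *\<^sub>R h + of_int (y i) *\<^sub>R (real N *\<^sub>R h - (\<Sum>j\<in>{..<n}-{i}. of_int (d j) *\<^sub>R b j))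
          + (\<Sum>j\<in>{..<n}-{i}. of_int (y j) *\<^sub>R b j)
        = of_int (s + y i * int N) *\<^sub>R h + (\<Sum>j\<in>{..<n}-{i}. of_int (y j - y i * d j) *\<^sub>R b j)"
        by (simp add: scaleR_sum_right sum_subtractf scaleR_diff_left scaleR_diff_right scaleR_add_left)
      also have "\<dots> = (\<Sum>j<n. of_int (if j = i then s + y i * int N else y j - y i * d j) *\<^sub>R d' j)"
        using i(1) by (subst (2) sum.remove[of _ i]) (auto simp: d'_def intro!: sum.cong)
      finally obtain Z :: "nat \<Rightarrow> int" where Z: "v = (\<Sum>j<n. of_int (Z j) *\<^sub>R d' j)" by (rule that)
      have "(\<Sum>j<n. Z j * M $$ (j, l)) = (if m = l then 1 else 0)" if l: "l < n" for l
      proof -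
        have "real_of_int (\<Sum>j<n. Z j * M $$ (j, l)) = (\<Sum>j<n. of_int (Z j) * B (d' j) (f' l))"
          using l by (simp add: Mreal)
        also have "\<dots> = B v (f' l)"
          unfolding Z using l f'L[OF l] d's
          by (subst form_sum_left) (auto simp: form_scale_left dual_in_span span_base span_scale)
        also have "\<dots> = real_of_int (if m = l then 1 else 0)" using vf[OF l] by simp
        finally show ?thesis by (simp only: of_int_eq_iff)
      qed
      then show ?thesis by blast
    qed
    then obtain Z :: "nat \<Rightarrow> nat \<Rightarrow> int"
      where Z: "\<And>m l. m < n \<Longrightarrow> l < n \<Longrightarrow> (\<Sum>j<n. Z m j * M $$ (j, l)) = (if m = l then 1 else 0)"
      by metis
    have "mat n n (\<lambda>(m, j). Z m j) * M = 1\<^sub>m n"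
      using Mc Z by (auto intro!: eq_matI simp: scalar_prod_def lessThan_atLeast0)
    then have "det (mat n n (\<lambda>(m, j). Z m j)) * det M = 1"
      using det_mult[of "mat n n (\<lambda>(m, j). Z m j)" n M] Mc by simp
    then have detM: "det M * det M = 1" by (metis mult.commute pos_zmult_eq_1_iff zmult_eq_1_iff mult_1 mult_minus1 minus_minus)
    \<comment> \<open>Scaling column \<open>i\<close> of \<open>E\<close> by \<open>q\<close> and
      scaling row \<open>i\<close> of \<open>M\<close> by \<open>q\<close> give the same matrix,
      because \<open>q * q = N\<close>; the transposes turn both into row operations.\<close>
    have "multrow i (int q) E\<^sup>T = (multrow i (int q) M)\<^sup>T"
    proof (rule eq_matI)
      fix j k assume "j < dim_row (multrow i (int q) M)\<^sup>T" "k < dim_col (multrow i (int q) M)\<^sup>T"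
      then have jk: "j < n" "k < n" using Mc by auto
      have "real_of_int (multrow i (int q) E\<^sup>T $$ (j, k)) = (if j = i then real q else 1) * B (e k) (e j)"
        using jk Ec by (simp add: Ereal)
      also have "\<dots> = (if k = i then real q else 1) * B (d' k) (f' j)"
        using jk hs bsp by (auto simp: e_def d'_def f'_def form_scale_left form_scale_right span_scale simp flip: qq)
      also have "\<dots> = real_of_int ((multrow i (int q) M)\<^sup>T $$ (j, k))"
        using jk Mc by (simp add: Mreal)
      finally show "multrow i (int q) E\<^sup>T $$ (j, k) = (multrow i (int q) M)\<^sup>T $$ (j, k)"
        by (simp only: of_int_eq_iff)
    qed (use Ec Mc in auto)
    then have "det (multrow i (int q) E\<^sup>T) = det (multrow i (int q) M)"
      using Mc by (metis det_transpose multrow_carrier)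
    then have "int q * det E = int q * det M"
      using i(1) Ec Mc by (simp add: det_multrow[of _ n] det_transpose[of _ n])
    then show ?thesis using detM pos by simp
  qed
  ultimately have "n \<ge> 8"
    using even_unimodular_rank_ge_8[of n E] Eev i(1) by auto
  then show ?thesis using lattice_rank_eq_length[OF bs] by (simp add: n_def)
qed

section \<open>Recognising the cyclic module\<close>

lemma qform_cyclic_module:
  "qform (cyclic_module p r a) x = mod_Ints (of_int a / of_nat (p ^ r) * (of_int x)\<^sup>2)"
  by (simp add: cyclic_module_def Let_def)

text \<open>The isometry is the inverse of the map sending \<open>k\<close> to the coset of
  \<open>k * t\<close> times \<open>g\<close>. It is bijective since \<open>t\<close> is a unit, and
  the form takes the value \<alpha> t^2 k^2 / p^r there, which is a k^2 / p^r modulo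
  integers.\<close>

lemma (in even_lattice_space) isometric_cyclic_moduleI:
  fixes \<alpha> t a :: int
  assumes p: "p > 0" and g: "g \<in> dual_lattice L B"
    and gen: "\<And>v. v \<in> dual_lattice L B \<Longrightarrow> \<exists>k::int. v - of_int k *\<^sub>R g \<in> L"
    and ord: "\<And>k::int. of_int k *\<^sub>R g \<in> L \<longleftrightarrow> int (p ^ r) dvd k"
    and Q: "B g g / 2 = of_int \<alpha> / real (p ^ r)"
    and t: "[\<alpha> * t\<^sup>2 = a] (mod int (p ^ r))" "coprime t (int (p ^ r))"
  shows "isometrically_isomorphic (discriminant_module L B) (cyclic_module p r a)"
proof -
  define N where "N = p ^ r"
  have N: "N > 0" using p by (simp add: N_def)
  note ord = ord[folded N_def] and t = t[folded N_def] and Q = Q[folded N_def]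
  let ?D = "discriminant_module L B" and ?C = "cyclic_module p r a"
  have cC: "carrier ?C = {0..<int N}" using carrier_cyclic_module[OF p] by (simp add: N_def)
  define \<phi> where "\<phi> k = lattice_coset (of_int (k * t) *\<^sub>R g)" for k :: int
  have \<phi>_eq: "\<phi> j = \<phi> k \<longleftrightarrow> int N dvd j - k" for j k
  proof -
    have "\<phi> j = \<phi> k \<longleftrightarrow> of_int ((j - k) * t) *\<^sub>R g \<in> L"
      unfolding \<phi>_def lattice_coset_eq_iff by (simp add: algebra_simps)
    also have "\<dots> \<longleftrightarrow> int N dvd (j - k) * t" by (rule ord)
    also have "\<dots> \<longleftrightarrow> int N dvd j - k"
      using t(2) by (simp add: coprime_dvd_mult_left_iff coprime_commute)
    finally show ?thesis .
  qed
  have inj: "inj_on \<phi> {0..<int N}"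
    by (intro inj_onI) (auto simp: \<phi>_eq mod_eq_dvd_iff[symmetric])
  have "\<phi> ` {0..<int N} = carrier ?D"
  proof safe
    fix k show "\<phi> k \<in> carrier ?D"
      unfolding \<phi>_def carrier_discriminant_module by (intro imageI dual_scale g)
  next
    fix X assume "X \<in> carrier ?D"
    then obtain v where v: "v \<in> dual_lattice L B" "X = lattice_coset v"
      unfolding carrier_discriminant_module by blast
    obtain k :: int where k: "v - of_int k *\<^sub>R g \<in> L" using gen[OF v(1)] by blast
    obtain u where "[t * u = 1] (mod int N)" using cong_solve_coprime_int[OF t(2)] by blast
    then have u: "int N dvd t * u - 1" by (simp add: cong_iff_dvd_diff)
    \<comment> \<open>\<open>u\<close> inverts \<open>t\<close> modulo \<open>N\<close>, so
      \<open>j\<close> is the index whose image is the coset of \<open>k\<close> times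
      \<open>g\<close>.\<close>
    define j where "j = (k * u) mod int N"
    have "int N dvd k * u - j" unfolding j_def by (metis dvd_minus_mod)
    then have "int N dvd k * (t * u - 1) - (k * u - j) * t" using u by (simp add: dvd_diff)
    also have "k * (t * u - 1) - (k * u - j) * t = j * t - k" by (simp add: algebra_simps)
    finally have "of_int (j * t - k) *\<^sub>R g \<in> L" using ord by blast
    from lattice_diff[OF k this] have "v - of_int (j * t) *\<^sub>R g \<in> L" by (simp add: algebra_simps)
    then have "X = \<phi> j" unfolding v \<phi>_def lattice_coset_eq_iff .
    moreover have "j \<in> {0..<int N}" using N by (simp add: j_def)
    ultimately show "X \<in> \<phi> ` {0..<int N}" by blast
  qed
  with inj have bij: "bij_betw \<phi> {0..<int N} (carrier ?D)" by (simp add: bij_betw_def)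
  define f where "f = inv_into {0..<int N} \<phi>"
  have f\<phi>: "f (\<phi> k) = k" if "k \<in> {0..<int N}" for k
    unfolding f_def using inj that by (rule inv_into_f_f)
  have ex: "\<exists>k\<in>{0..<int N}. X = \<phi> k" if "X \<in> carrier ?D" for X
    using bij that unfolding bij_betw_def by blast
  have "f \<in> iso ?D ?C"
    unfolding iso_def hom_def
  proof (safe intro!: funcsetI)
    show "bij_betw f (carrier ?D) (carrier ?C)"
      unfolding cC f_def by (rule bij_betw_inv_into[OF bij])
    then show "f X \<in> carrier ?C" if "X \<in> carrier ?D" for X
      using that by (metis bij_betwE)
    fix X Y assume "X \<in> carrier ?D" "Y \<in> carrier ?D"
    then obtain j k where jk: "j \<in> {0..<int N}" "k \<in> {0..<int N}" "X = \<phi> j" "Y = \<phi> k"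
      using ex by metis
    have "X \<otimes>\<^bsub>?D\<^esub> Y = \<phi> (j + k)"
      by (simp add: jk \<phi>_def mult_discriminant_module algebra_simps)
    also have "\<dots> = \<phi> ((j + k) mod int N)"
      unfolding \<phi>_eq by (metis dvd_minus_mod)
    finally have "f (X \<otimes>\<^bsub>?D\<^esub> Y) = (j + k) mod int N"
      using N by (simp add: f\<phi>)
    then show "f (X \<otimes>\<^bsub>?D\<^esub> Y) = f X \<otimes>\<^bsub>?C\<^esub> f Y"
      using jk by (simp add: f\<phi> mult_cyclic_module N_def)
  qed
  moreover have "qform ?C (f X) = qform ?D X" if X: "X \<in> carrier ?D" for X
  proof -
    obtain k where k: "k \<in> {0..<int N}" "X = \<phi> k" using ex[OF X] by blast
    have "B (of_int (k * t) *\<^sub>R g) (of_int (k * t) *\<^sub>R g) / 2 = (of_int (k * t))\<^sup>2 * (B g g / 2)"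
      using dual_in_span[OF g] by (simp only: form_scale_left form_scale_right span_scale) (simp add: power2_eq_square)
    then have "qform ?D X = mod_Ints ((of_int (k * t))\<^sup>2 * (B g g / 2))"
      unfolding k \<phi>_def qform_discriminant_module[OF dual_scale[OF g]] by simp
    moreover obtain s where s: "a = \<alpha> * t\<^sup>2 + int N * s"
      using t(1) by (auto simp: cong_iff_lin)
    have "of_int a / real N * (of_int k)\<^sup>2 - (of_int (k * t))\<^sup>2 * (B g g / 2) = of_int (s * k\<^sup>2)"
      unfolding Q s using N by (simp add: field_simps power_mult_distrib)
    then have "mod_Ints (of_int a / real N * (of_int k)\<^sup>2) = mod_Ints ((of_int (k * t))\<^sup>2 * (B g g / 2))"
      unfolding mod_Ints_eq_iff by (metis Ints_of_int)
    ultimately show ?thesis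
      using k by (simp add: f\<phi> qform_cyclic_module N_def)
  qed
  ultimately show ?thesis unfolding isometrically_isomorphic_def by blast
qed

section \<open>Square classes modulo prime powers\<close>

text \<open>Hensel lifting by a Newton step: if b = y^2 + p^r m and \<open>s\<close> inverts 2 y
  modulo \<open>p\<close>, the next root is y + p^r s m.\<close>

lemma sqrt_mod_prime_power:
  fixes b :: int
  assumes p: "prime p" "odd p" and b: "\<not> int p dvd b" "QuadRes (int p) b"
  shows "\<exists>y. [y\<^sup>2 = b] (mod int (p ^ r))"
proof (induction r)
  case 0
  then show ?case by (auto simp: cong_def)
next
  case (Suc r)
  show ?case
  proof (cases "r = 0")
    case True
    then show ?thesis using b(2) by (auto simp: QuadRes_def)
  next
    case False
    obtain y where y: "[y\<^sup>2 = b] (mod int (p ^ r))" using Suc by blast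
    then obtain m where m: "b = y\<^sup>2 + int (p ^ r) * m" by (auto simp: cong_iff_lin)
    have "\<not> int p dvd y"
    proof
      assume "int p dvd y"
      then have "int p dvd y\<^sup>2" by (simp add: power2_eq_square)
      moreover have "int p dvd int (p ^ r) * m" using False by (simp add: dvd_mult2 dvd_power)
      ultimately show False using b(1) m by simp
    qed
    moreover have "\<not> int p dvd 2"
      using p by (metis int_dvd_int_iff of_nat_numeral primes_dvd_imp_eq two_is_prime_nat even_numeral dvd_refl)
    ultimately have "\<not> int p dvd 2 * y" using p(1) by (simp add: prime_dvd_mult_iff)
    then have "coprime (2 * y) (int p)"
      using p(1) by (metis coprime_commute prime_imp_coprime prime_nat_int_transfer)
    then obtain s where "[2 * y * s = 1] (mod int p)" using cong_solve_coprime_int by blast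
    then obtain s' where s': "1 = 2 * y * s + int p * s'" by (auto simp: cong_iff_lin)
    \<comment> \<open>For positive \<open>r\<close> the quadratic error is divisible by
      \<open>p ^ (2 * r) = p ^ Suc r * p ^ r'\<close>.\<close>
    obtain r' where r': "r = Suc r'" using False by (cases r) auto
    have "b - (y + int (p ^ r) * (s * m))\<^sup>2
        = int (p ^ r) * (m * 1) - 2 * y * int (p ^ r) * s * m - int (p ^ r) * int (p ^ r) * (s * m)\<^sup>2"
      unfolding m by (simp add: power2_eq_square algebra_simps)
    also have "\<dots> = int (p ^ Suc r) * (m * s' - int (p ^ r') * (s * m)\<^sup>2)"
      unfolding s' by (simp add: r' algebra_simps)
    finally have "int (p ^ Suc r) dvd b - (y + int (p ^ r) * (s * m))\<^sup>2" by simp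
    then show ?thesis by (metis cong_iff_dvd_diff cong_sym)
  qed
qed

text \<open>Euler's criterion shows that \<open>a * \<alpha>\<close> is a residue. Its root
  \<open>y\<close> modulo \<open>p ^ r\<close>, divided by \<open>\<alpha>\<close>, is the required
  \<open>t\<close>.\<close>

lemma Legendre_eq_imp_square_multiple:
  fixes a \<alpha> :: int
  assumes p: "prime p" "odd p" and a: "\<not> int p dvd a" and L: "Legendre \<alpha> (int p) = Legendre a (int p)"
  obtains t where "[\<alpha> * t\<^sup>2 = a] (mod int (p ^ r))" "coprime t (int (p ^ r))"
proof -
  have p2: "2 < p" using p prime_ge_2_nat[OF p(1)] by (metis even_numeral le_neq_implies_less)
  have La: "Legendre a (int p) * Legendre a (int p) = 1"
    using a by (auto simp: Legendre_def cong_0_iff)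
  have nd\<alpha>: "\<not> int p dvd \<alpha>"
    using L La by (auto simp: Legendre_def cong_0_iff split: if_splits)
  have nd: "\<not> int p dvd a * \<alpha>" using a nd\<alpha> p(1) by (simp add: prime_dvd_mult_iff)
  have "[Legendre (a * \<alpha>) (int p) = (a * \<alpha>) ^ ((p - 1) div 2)] (mod int p)"
    by (rule euler_criterion[OF p(1) p2])
  also have "(a * \<alpha>) ^ ((p - 1) div 2) = a ^ ((p - 1) div 2) * \<alpha> ^ ((p - 1) div 2)"
    by (rule power_mult_distrib)
  also have "[a ^ ((p - 1) div 2) * \<alpha> ^ ((p - 1) div 2) = Legendre a (int p) * Legendre \<alpha> (int p)] (mod int p)"
    by (intro cong_mult cong_sym[OF euler_criterion[OF p(1) p2]])
  also have "Legendre a (int p) * Legendre \<alpha> (int p) = 1" using L La by simp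
  finally have "[Legendre (a * \<alpha>) (int p) = 1] (mod int p)" .
  moreover have "\<not> [- 1 = 1] (mod int p)"
    using p2 zdvd_not_zless[of 2 "int p"] by (auto simp: cong_iff_dvd_diff)
  ultimately have "QuadRes (int p) (a * \<alpha>)"
    using nd by (auto simp: Legendre_def cong_0_iff split: if_splits)
  then obtain y where y: "[y\<^sup>2 = a * \<alpha>] (mod int (p ^ r))"
    using sqrt_mod_prime_power[OF p nd] by blast
  have cop: "coprime x (int (p ^ r))" if "\<not> int p dvd x" for x
    using that p(1)
    by (metis coprime_commute coprime_power_right_iff of_nat_power prime_imp_coprime prime_nat_int_transfer)
  obtain u where u: "[\<alpha> * u = 1] (mod int (p ^ r))" using cong_solve_coprime_int[OF cop[OF nd\<alpha>]] by blast
  have "[\<alpha> * (y * u)\<^sup>2 = a] (mod int (p ^ r))"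
  proof -
    have "\<alpha> * (y * u)\<^sup>2 = y\<^sup>2 * (\<alpha> * u) * u" by (simp add: power2_eq_square)
    also have "[y\<^sup>2 * (\<alpha> * u) * u = (a * \<alpha>) * 1 * u] (mod int (p ^ r))"
      by (intro cong_mult y u cong_refl)
    also have "(a * \<alpha>) * 1 * u = a * (\<alpha> * u)" by simp
    also have "[a * (\<alpha> * u) = a * 1] (mod int (p ^ r))" by (intro cong_mult u cong_refl)
    finally show ?thesis by simp
  qed
  moreover have "coprime (y * u) (int (p ^ r))"
  proof -
    have "coprime (y\<^sup>2) (int (p ^ r))" using cong_imp_coprime[OF cong_sym[OF y]] cop[OF nd] by simp
    moreover have "coprime u (int (p ^ r))"
      using cong_imp_coprime[OF cong_sym[OF u]] by auto
    ultimately show ?thesis by auto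
  qed
  ultimately show thesis by (rule that)
qed

section \<open>The lattices of rank 8\<close>

unbundle vec_syntax
unbundle inner_syntax
no_notation vec_index (infixl "$" 100)
no_notation scalar_prod (infix "\<bullet>" 70)

section \<open>Coordinates in dimension 8\<close>

lemma exhaust_8:
  fixes x :: 8
  shows "x = 1 \<or> x = 2 \<or> x = 3 \<or> x = 4 \<or> x = 5 \<or> x = 6 \<or> x = 7 \<or> x = 8"
proof (induct x)
  case (of_int z)
  then have "0 \<le> z" and "z < 8" by simp_all
  then have "z = 0 \<or> z = 1 \<or> z = 2 \<or> z = 3 \<or> z = 4 \<or> z = 5 \<or> z = 6 \<or> z = 7" by arith
  then show ?case by auto
qed

lemma forall_8: "(\<forall>i::8. P i) \<longleftrightarrow> P 1 \<and> P 2 \<and> P 3 \<and> P 4 \<and> P 5 \<and> P 6 \<and> P 7 \<and> P 8"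
  by (metis exhaust_8)

lemma UNIV_8: "UNIV = {1, 2, 3, 4, 5, 6, 7, 8 :: 8}"
  using exhaust_8 by auto

lemma sum_8: "sum f (UNIV :: 8 set) = f 1 + f 2 + f 3 + f 4 + f 5 + f 6 + f 7 + f 8"
  unfolding UNIV_8 by (simp add: ac_simps)

lemma vector_8:
  fixes a b c d e f g h :: "'a::zero"
  shows "(vector [a, b, c, d, e, f, g, h] :: 'a ^ 8) $ 1 = a"
    "(vector [a, b, c, d, e, f, g, h] :: 'a ^ 8) $ 2 = b"
    "(vector [a, b, c, d, e, f, g, h] :: 'a ^ 8) $ 3 = c"
    "(vector [a, b, c, d, e, f, g, h] :: 'a ^ 8) $ 4 = d"
    "(vector [a, b, c, d, e, f, g, h] :: 'a ^ 8) $ 5 = e"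
    "(vector [a, b, c, d, e, f, g, h] :: 'a ^ 8) $ 6 = f"
    "(vector [a, b, c, d, e, f, g, h] :: 'a ^ 8) $ 7 = g"
    "(vector [a, b, c, d, e, f, g, h] :: 'a ^ 8) $ 8 = h"
  by (simp_all add: vector_def)

section \<open>The form of \<open>gram8\<close> on the standard lattice\<close>

lemma gram_form_gram8:
  "gram_form (gram8 g11 g12 g22 g23 g33) x y =
     x$1 * (g11 * y$1 + g12 * y$2) +
     x$2 * (g12 * y$1 + g22 * y$2 + g23 * y$3) +
     x$3 * (g23 * y$2 + g33 * y$3 + y$4) +
     x$4 * (y$3 + 2 * y$4 + y$5) +
     x$5 * (y$4 + 2 * y$5 + y$6) +
     x$6 * (y$5 + 2 * y$6 + y$7) +
     x$7 * (y$6 + 2 * y$7 + y$8) +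
     x$8 * (y$7 + 2 * y$8)"
  unfolding gram_form_def gram8_def inner_vec_def matrix_vector_mult_def sum_8
  by (simp add: vector_8 sum_8)

lemma bilinear_gram_form: "bilinear (gram_form G)"
  unfolding bilinear_def gram_form_def
  by (auto intro!: linearI simp: inner_simps matrix_vector_right_distrib matrix_vector_mult_scaleR)

lemma gram_form_gram8_sym:
  "gram_form (gram8 g11 g12 g22 g23 g33) x y = gram_form (gram8 g11 g12 g22 g23 g33) y x"
  unfolding gram_form_gram8 by (simp add: algebra_simps)

text \<open>Eliminating coordinates 8 down to 4 yields the pivots 2, 3/2, 4/3, 5/4, 6/5 and leaves
  \<open>g33 - 5 / 6\<close> for coordinate 3. Eliminating coordinates 1 and 3 leaves the third
  assumed positive quantity as the pivot of coordinate 2.\<close>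

lemma gram_form_gram8_pos:
  assumes "g11 > 0" "g33 > 5 / 6" "g22 - g12\<^sup>2 / g11 - g23\<^sup>2 / (g33 - 5 / 6) > 0" "x \<noteq> 0"
  shows "gram_form (gram8 g11 g12 g22 g23 g33) x x > 0"
proof -
  define h where "h = g33 - 5 / 6"
  have h: "h > 0" using assms(2) by (simp add: h_def)
  define d where "d = g22 - g12\<^sup>2 / g11 - g23\<^sup>2 / h"
  have d: "d > 0" using assms(3) by (simp add: d_def h_def)
  have g22: "g22 = d + g12\<^sup>2 / g11 + g23\<^sup>2 / h" by (simp add: d_def)
  have g33: "g33 = h + 5 / 6" by (simp add: h_def)
  have eq: "gram_form (gram8 g11 g12 g22 g23 g33) x x =
      g11 * (x$1 + g12 / g11 * x$2)\<^sup>2 + d * (x$2)\<^sup>2 + h * (x$3 + g23 / h * x$2)\<^sup>2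
      + 6/5 * (x$4 + 5/6 * x$3)\<^sup>2 + 5/4 * (x$5 + 4/5 * x$4)\<^sup>2 + 4/3 * (x$6 + 3/4 * x$5)\<^sup>2
      + 3/2 * (x$7 + 2/3 * x$6)\<^sup>2 + 2 * (x$8 + 1/2 * x$7)\<^sup>2"
    unfolding gram_form_gram8 g22 g33 using assms(1) h
    by (simp add: field_simps power2_eq_square)
  have nonneg: "0 \<le> g11 * s\<^sup>2" "0 \<le> d * s\<^sup>2" "0 \<le> h * s\<^sup>2" for s
    using assms(1) h d by simp_all
  have "gram_form (gram8 g11 g12 g22 g23 g33) x x \<ge> 0"
    unfolding eq using nonneg by (intro add_nonneg_nonneg) auto
  moreover have "gram_form (gram8 g11 g12 g22 g23 g33) x x \<noteq> 0"
  proof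
    assume "gram_form (gram8 g11 g12 g22 g23 g33) x x = 0"
    then have "g11 * (x$1 + g12 / g11 * x$2)\<^sup>2 = 0 \<and> d * (x$2)\<^sup>2 = 0 \<and> h * (x$3 + g23 / h * x$2)\<^sup>2 = 0
      \<and> (x$4 + 5/6 * x$3)\<^sup>2 = 0 \<and> (x$5 + 4/5 * x$4)\<^sup>2 = 0 \<and> (x$6 + 3/4 * x$5)\<^sup>2 = 0
      \<and> (x$7 + 2/3 * x$6)\<^sup>2 = 0 \<and> (x$8 + 1/2 * x$7)\<^sup>2 = 0"
      unfolding eq
      using nonneg(1)[of "x$1 + g12 / g11 * x$2"] nonneg(2)[of "x$2"] nonneg(3)[of "x$3 + g23 / h * x$2"]
        zero_le_power2[of "x$4 + 5/6 * x$3"] zero_le_power2[of "x$5 + 4/5 * x$4"]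
        zero_le_power2[of "x$6 + 3/4 * x$5"] zero_le_power2[of "x$7 + 2/3 * x$6"]
        zero_le_power2[of "x$8 + 1/2 * x$7"]
      by argo
    then have "x = 0" using assms(1) h d by (auto simp: Finite_Cartesian_Product.vec_eq_iff forall_8)
    with assms(4) show False by simp
  qed
  ultimately show ?thesis by simp
qed

text \<open>A kernel vector yields a combination \<open>x\<close> orthogonal to all basis vectors,
  hence of norm 0 and therefore zero; independence then kills its coefficients.\<close>

lemma gram_matrix_det_nonzero:
  fixes B :: "'v::real_vector \<Rightarrow> 'v \<Rightarrow> real"
  assumes bs: "distinct bs" "independent (set bs)" and bil: "bilinear B"
    and pd: "\<And>x. x \<noteq> 0 \<Longrightarrow> B x x \<noteq> 0"
  shows "det (gram_matrix B bs) \<noteq> 0"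
proof
  assume "det (gram_matrix B bs) = 0"
  moreover have G: "gram_matrix B bs \<in> carrier_mat (length bs) (length bs)"
    by (simp add: gram_matrix_def)
  ultimately obtain c where c: "c \<in> carrier_vec (length bs)" "c \<noteq> 0\<^sub>v (length bs)"
    "gram_matrix B bs *\<^sub>v c = 0\<^sub>v (length bs)"
    using det_0_iff_vec_prod_zero[OF G] by blast
  define x where "x = (\<Sum>j<length bs. vec_index c j *\<^sub>R bs ! j)"
  have "B (bs ! i) x = 0" if i: "i < length bs" for i
  proof -
    have "B (bs ! i) x = (\<Sum>j<length bs. vec_index c j * B (bs ! i) (bs ! j))"
      using bil unfolding x_def bilinear_def by (simp add: linear_sum linear_scale)
    also have "\<dots> = vec_index (gram_matrix B bs *\<^sub>v c) i"
      using i c(1) by (simp add: gram_matrix_def scalar_prod_def lessThan_atLeast0 mult.commute)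
    finally show ?thesis using i c(3) by simp
  qed
  moreover have "B x y = (\<Sum>j<length bs. vec_index c j * B (bs ! j) y)" for y
  proof -
    have "linear (\<lambda>x. B x y)" using bil by (simp add: bilinear_def)
    note l = linear_sum[OF this] linear_scale[OF this]
    show ?thesis unfolding x_def by (simp only: l real_scaleR_def)
  qed
  ultimately have "B x x = 0" by simp
  then have x0: "x = 0" using pd by blast
  have "vec_index c k = 0" if "k < length bs" for k
    using independent_list_coeffs_zero[OF bs _ that] x0 by (simp add: x_def)
  then have "c = 0\<^sub>v (length bs)" using c(1) by (auto intro!: eq_vecI)
  with c(2) show False by simp
qed

lemma lattice_basis_integer_vectors:
  "lattice_basis (integer_vectors :: (real ^ 8) set) (map (\<lambda>i. axis i 1) [1, 2, 3, 4, 5, 6, 7, 8])"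
proof -
  let ?bs = "map (\<lambda>i::8. axis i (1::real)) [1, 2, 3, 4, 5, 6, 7, 8]"
  have dist: "distinct ?bs" by (simp add: axis_eq_axis)
  have "set ?bs \<subseteq> Basis" by (auto simp: Basis_vec_def)
  then have ind: "independent (set ?bs)" by (rule independent_mono[OF independent_Basis])
  have sum: "(\<Sum>i<length ?bs. of_int (c i) *\<^sub>R ?bs ! i)
      = vector [of_int (c 0), of_int (c 1), of_int (c 2), of_int (c 3), of_int (c 4), of_int (c 5),
          of_int (c 6), of_int (c 7)]" for c :: "nat \<Rightarrow> int"
    by (simp add: Finite_Cartesian_Product.vec_eq_iff forall_8 vector_8 eval_nat_numeral axis_def)
  have "integer_vectors = {\<Sum>i<length ?bs. of_int (c i) *\<^sub>R ?bs ! i | c :: nat \<Rightarrow> int. True}"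
  proof safe
    fix x :: "real ^ 8" assume "x \<in> integer_vectors"
    then have x: "of_int \<lfloor>x $ i\<rfloor> = x $ i" for i by (simp add: integer_vectors_def)
    \<comment> \<open>List positions start at 0 and axes at 1, so position \<open>i\<close> belongs
      to axis \<open>of_nat (Suc i)\<close>.\<close>
    have "x = (\<Sum>i<length ?bs. of_int \<lfloor>x $ of_nat (Suc i)\<rfloor> *\<^sub>R ?bs ! i)"
      unfolding sum by (simp add: Finite_Cartesian_Product.vec_eq_iff forall_8 vector_8 x)
    then show "\<exists>c :: nat \<Rightarrow> int. x = (\<Sum>i<length ?bs. of_int (c i) *\<^sub>R ?bs ! i) \<and> True"
      by (intro exI[of _ "\<lambda>i. \<lfloor>x $ of_nat (Suc i)\<rfloor>"] conjI TrueI)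
  next
    fix c :: "nat \<Rightarrow> int"
    show "(\<Sum>i<length ?bs. of_int (c i) *\<^sub>R ?bs ! i) \<in> integer_vectors"
      unfolding sum by (simp add: integer_vectors_def forall_8 vector_8)
  qed
  with dist ind show ?thesis by (simp add: lattice_basis_def)
qed

lemma lattice_rank_integer_vectors: "lattice_rank (integer_vectors :: (real ^ 8) set) = 8"
  using lattice_rank_eq_length[OF lattice_basis_integer_vectors] by simp

lemma span_integer_vectors: "span (integer_vectors :: (real ^ 'n) set) = UNIV"
proof -
  have "Basis \<subseteq> (integer_vectors :: (real ^ 'n) set)"
    by (auto simp: Basis_vec_def integer_vectors_def axis_def)
  then show ?thesis by (metis span_Basis span_mono top.extremum_uniqueI)
qed

lemma even_lattice_gram8:
  fixes \<alpha> \<beta> \<gamma> \<mu> \<xi> :: int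
  assumes "g11 = 2 * of_int \<alpha>" "g12 = of_int \<mu>" "g22 = 2 * of_int \<xi>" "g23 = of_int \<gamma>" "g33 = 2 * of_int \<beta>"
    and pos: "g11 > 0" "g33 > 5 / 6" "g22 - g12\<^sup>2 / g11 - g23\<^sup>2 / (g33 - 5 / 6) > 0"
  shows "even_lattice integer_vectors (gram_form (gram8 g11 g12 g22 g23 g33))"
proof -
  let ?B = "gram_form (gram8 g11 g12 g22 g23 g33)"
  have bil: "bilinear ?B" by (rule bilinear_gram_form)
  have "det (gram_matrix ?B (map (\<lambda>i. axis i 1) [1, 2, 3, 4, 5, 6, 7, 8])) \<noteq> 0"
    using lattice_basis_integer_vectors gram_form_gram8_pos[OF pos] bil
    unfolding lattice_basis_def by (intro gram_matrix_det_nonzero) force+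
  then have "is_lattice integer_vectors ?B"
    unfolding is_lattice_def using lattice_basis_integer_vectors gram_form_gram8_sym
      bilinear_ladd[OF bil] bilinear_lmul[OF bil] by (metis real_scaleR_def)
  moreover have "?B x y \<in> \<int>" if "x \<in> integer_vectors" "y \<in> integer_vectors" for x y
    using that unfolding gram_form_gram8 assms(1-5) integer_vectors_def
    by (intro Ints_add Ints_mult) auto
  moreover have "\<exists>k::int. ?B x x = 2 * of_int k" if x: "x \<in> integer_vectors" for x
  proof -
    define z where "z i = \<lfloor>x $ i\<rfloor>" for i
    have x: "x $ i = of_int (z i)" for i using x by (simp add: integer_vectors_def z_def)
    have "?B x x = 2 * of_int (\<alpha> * z 1 * z 1 + \<mu> * z 1 * z 2 + \<xi> * z 2 * z 2 + \<gamma> * z 2 * z 3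
        + \<beta> * z 3 * z 3 + z 3 * z 4 + z 4 * z 4 + z 4 * z 5 + z 5 * z 5 + z 5 * z 6 + z 6 * z 6
        + z 6 * z 7 + z 7 * z 7 + z 7 * z 8 + z 8 * z 8)"
      unfolding gram_form_gram8 assms(1-5) x by (simp add: algebra_simps)
    then show ?thesis by (rule exI)
  qed
  ultimately show ?thesis unfolding even_lattice_def by blast
qed

text \<open>
  The last assumption says that the matrix obtained from \<open>G\<close> by dividing its first column by \<open>N\<close>
  is unimodular.
\<close>

lemma discriminant_gram8:
  fixes \<alpha> \<beta> \<gamma> \<xi> v t a :: int and p r :: nat
  defines "N \<equiv> real p ^ r"
  defines "G \<equiv> gram8 (2 * of_int \<alpha> * N) (N * of_int v) (2 * of_int \<xi>) (of_int \<gamma>) (2 * of_int \<beta>)"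
  assumes p: "p > 0" and t: "[\<alpha> * t\<^sup>2 = a] (mod int (p ^ r))" "coprime t (int (p ^ r))"
    and pos: "\<alpha> > 0" "\<beta> > 0"
      "2 * of_int \<xi> - N * (of_int v)\<^sup>2 / (2 * of_int \<alpha>) - (of_int \<gamma>)\<^sup>2 / (2 * of_int \<beta> - 5 / 6) > 0"
    and unimod: "\<And>w1 w2 w3 w4 w5 w6 w7 w8 :: real. \<lbrakk>2 * of_int \<alpha> * w1 + N * of_int v * w2 \<in> \<int>;
       of_int v * w1 + 2 * of_int \<xi> * w2 + of_int \<gamma> * w3 \<in> \<int>; of_int \<gamma> * w2 + 2 * of_int \<beta> * w3 + w4 \<in> \<int>;
       w3 + 2 * w4 + w5 \<in> \<int>; w4 + 2 * w5 + w6 \<in> \<int>; w5 + 2 * w6 + w7 \<in> \<int>; w6 + 2 * w7 + w8 \<in> \<int>;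
       w7 + 2 * w8 \<in> \<int>\<rbrakk> \<Longrightarrow> w1 \<in> \<int> \<and> w2 \<in> \<int> \<and> w8 \<in> \<int>"
  shows "even_lattice integer_vectors (gram_form G)"
    and "positive_definite integer_vectors (gram_form G)"
    and "isometrically_isomorphic (discriminant_module integer_vectors (gram_form G)) (cyclic_module p r a)"
proof -
  have N: "N > 0" using p by (simp add: N_def)
  have NZ: "N = of_int (int (p ^ r))" by (simp add: N_def)
  have pos': "2 * of_int \<alpha> * N > 0" "2 * of_int \<beta> > (5 / 6 :: real)"
    using pos(1,2) N by simp_all
  have "(N * of_int v)\<^sup>2 / (2 * of_int \<alpha> * N) = N * (of_int v)\<^sup>2 / (2 * of_int \<alpha>)"
    using N by (simp add: power2_eq_square)
  then have pos'': "2 * of_int \<xi> - (N * of_int v)\<^sup>2 / (2 * of_int \<alpha> * N) - (of_int \<gamma>)\<^sup>2 / (2 * of_int \<beta> - 5 / 6) > 0"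
    using pos(3) by simp
  show ev: "even_lattice integer_vectors (gram_form G)"
    unfolding G_def
    by (rule even_lattice_gram8[of _ "\<alpha> * int (p ^ r)" _ "int (p ^ r) * v" _ \<xi> _ \<gamma> _ \<beta>, OF _ _ _ _ _ pos' pos''])
      (simp_all add: N_def)
  show "positive_definite integer_vectors (gram_form G)"
    unfolding G_def positive_definite_def using gram_form_gram8_pos[OF pos' pos''] by blast
  interpret even_lattice_space integer_vectors "gram_form G"
    using ev by (rule even_lattice_spaceI)
  define g :: "real ^ 8" where "g = axis 1 (1 / N)"
  have g_nth: "g $ i = (if i = 1 then 1 / N else 0)" for i
    by (simp add: g_def axis_def)
  have axis_int: "axis i 1 \<in> integer_vectors" for i :: 8
    by (simp add: integer_vectors_def axis_def)
  show "isometrically_isomorphic (discriminant_module integer_vectors (gram_form G)) (cyclic_module p r a)"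
  proof (rule isometric_cyclic_moduleI[where g = g and \<alpha> = \<alpha> and t = t, OF p _ _ _ _ t])
    have "gram_form G g w = 2 * of_int \<alpha> * w $ 1 + of_int v * w $ 2" for w
      unfolding G_def gram_form_gram8 using N by (simp add: g_nth field_simps)
    then show "g \<in> dual_lattice integer_vectors (gram_form G)"
      unfolding dual_lattice_def span_integer_vectors by (auto simp: integer_vectors_def)
    show "gram_form G g g / 2 = of_int \<alpha> / real (p ^ r)"
      unfolding G_def gram_form_gram8 using N by (simp add: g_nth N_def)
    show "of_int k *\<^sub>R g \<in> integer_vectors \<longleftrightarrow> int (p ^ r) dvd k" for k :: int
    proof -
      have "of_int k *\<^sub>R g \<in> integer_vectors \<longleftrightarrow> of_int k / N \<in> \<int>"
        by (auto simp: integer_vectors_def g_nth)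
      also have "\<dots> \<longleftrightarrow> (\<exists>j::int. of_int k / N = of_int j)" by (auto elim: Ints_cases)
      also have "\<dots> \<longleftrightarrow> (\<exists>j::int. real_of_int k = of_int (int (p ^ r) * j))"
        using N unfolding NZ by (simp add: field_simps)
      also have "\<dots> \<longleftrightarrow> int (p ^ r) dvd k" by (simp only: of_int_eq_iff dvd_def)
      finally show ?thesis .
    qed
    show "\<exists>k::int. y - of_int k *\<^sub>R g \<in> integer_vectors"
      if y: "y \<in> dual_lattice integer_vectors (gram_form G)" for y
    proof -
      have "gram_form G y (axis i 1) \<in> \<int>" for i
        using y axis_int by (auto simp: dual_lattice_def)
      then have *: "gram_form G (axis i 1) y \<in> \<int>" for i
        unfolding G_def using gram_form_gram8_sym by metis
      \<comment> \<open>With \<open>N * y $ 1\<close> as the first unknown, the pairings with the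
        axes become the equations of the matrix with divided first column.\<close>
      have e: "2 * of_int \<alpha> * (N * y $ 1) + N * of_int v * y $ 2 \<in> \<int>"
        "of_int v * (N * y $ 1) + 2 * of_int \<xi> * y $ 2 + of_int \<gamma> * y $ 3 \<in> \<int>"
        "of_int \<gamma> * y $ 2 + 2 * of_int \<beta> * y $ 3 + y $ 4 \<in> \<int>"
        "y $ 3 + 2 * y $ 4 + y $ 5 \<in> \<int>" "y $ 4 + 2 * y $ 5 + y $ 6 \<in> \<int>"
        "y $ 5 + 2 * y $ 6 + y $ 7 \<in> \<int>" "y $ 6 + 2 * y $ 7 + y $ 8 \<in> \<int>"
        "y $ 7 + 2 * y $ 8 \<in> \<int>"
        using *[of 1] *[of 2] *[of 3] *[of 4] *[of 5] *[of 6] *[of 7] *[of 8]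
        unfolding G_def gram_form_gram8 by (simp_all add: axis_def algebra_simps)
      have u: "N * y $ 1 \<in> \<int>" "y $ 2 \<in> \<int>" "y $ 8 \<in> \<int>" using unimod[OF e] by auto
      \<comment> \<open>Unimodularity is invoked for coordinates 1, 2 and 8; the rest follow by back
        substitution from the last equation.\<close>
      have two: "2 * s \<in> \<int>" if "s \<in> \<int>" for s :: real using that by simp
      have y7: "y $ 7 \<in> \<int>" using Ints_diff[OF e(8) two[OF u(3)]] by simp
      have y6: "y $ 6 \<in> \<int>" using Ints_diff[OF Ints_diff[OF e(7) two[OF y7]] u(3)] by simp
      have y5: "y $ 5 \<in> \<int>" using Ints_diff[OF Ints_diff[OF e(6) two[OF y6]] y7] by simp
      have y4: "y $ 4 \<in> \<int>" using Ints_diff[OF Ints_diff[OF e(5) two[OF y5]] y6] by simp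
      have y3: "y $ 3 \<in> \<int>" using Ints_diff[OF Ints_diff[OF e(4) two[OF y4]] y5] by simp
      obtain k :: int where k: "N * y $ 1 = of_int k" using u(1) by (auto elim: Ints_cases)
      then have "y $ 1 = of_int k / N" using N by (simp add: field_simps)
      then have "y - of_int k *\<^sub>R g \<in> integer_vectors"
        using u y3 y4 y5 y6 y7 unfolding integer_vectors_def mem_Collect_eq forall_8
        by (simp add: g_nth)
      then show ?thesis by blast
    qed
  qed
qed

section \<open>Unimodularity for the two shapes of the matrix\<close>

text \<open>Stated for positive integers \<open>q\<close>, so that it serves prime \<open>q\<close>,
  the value 4 for \<open>p = 7\<close>, and the numbers (w^2 + 7) / 4 of the existence proof. The
  relation for \<open>\<xi>\<close> says that the divided matrix has determinant 1.\<close>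

lemma discriminant_gram8_F:
  fixes q \<xi> v t a :: int and p r :: nat
  defines "G \<equiv> gram8 (2 * of_int q * real p ^ r) (real p ^ r * of_int v) (2 * of_int \<xi>) 1 2"
  assumes p: "p > 0" and t: "[q * t\<^sup>2 = a] (mod int (p ^ r))" "coprime t (int (p ^ r))"
    and q: "q > 0" and \<xi>: "28 * q * \<xi> = 7 * int (p ^ r) * v\<^sup>2 + 12 * q + 1"
  shows "even_lattice integer_vectors (gram_form G)
    \<and> positive_definite integer_vectors (gram_form G)
    \<and> isometrically_isomorphic (discriminant_module integer_vectors (gram_form G)) (cyclic_module p r a)"
proof -
  have G: "G = gram8 (2 * of_int q * real p ^ r) (real p ^ r * of_int v) (2 * of_int \<xi>)
      (of_int 1) (2 * of_int 1)"
    by (simp add: G_def)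
  have "real_of_int (28 * q * \<xi>) = real_of_int (7 * int (p ^ r) * v\<^sup>2 + 12 * q + 1)"
    using \<xi> by (simp only:)
  then have \<xi>': "28 * of_int q * of_int \<xi> = 7 * (real p ^ r) * (of_int v)\<^sup>2 + 12 * of_int q + (1 :: real)"
    by simp
  have "2 * of_int \<xi> = (28 * of_int q * of_int \<xi>) / (14 * real_of_int q)"
    using q by (simp add: field_simps)
  \<comment> \<open>Here 6/7 is the reciprocal of \<open>2 - 5 / 6\<close>, and the pivot of
    coordinate 2 comes out as 1 / (14 q).\<close>
  then have "2 * of_int \<xi> - real p ^ r * (of_int v)\<^sup>2 / (2 * of_int q) - 6 / 7 = 1 / (14 * real_of_int q)"
    unfolding \<xi>' using q by (simp add: field_simps)
  then have pos: "2 * of_int \<xi> - real p ^ r * (of_int v)\<^sup>2 / (2 * of_int q)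
      - (of_int 1)\<^sup>2 / (2 * of_int 1 - 5 / 6) > (0 :: real)"
    using q by simp
  have unimod: "w1 \<in> \<int> \<and> w2 \<in> \<int> \<and> w8 \<in> \<int>"
    if n: "2 * of_int q * w1 + real p ^ r * of_int v * w2 \<in> \<int>"
       "of_int v * w1 + 2 * of_int \<xi> * w2 + of_int 1 * w3 \<in> \<int>" "of_int 1 * w2 + 2 * of_int 1 * w3 + w4 \<in> \<int>"
       "w3 + 2 * w4 + w5 \<in> \<int>" "w4 + 2 * w5 + w6 \<in> \<int>" "w5 + 2 * w6 + w7 \<in> \<int>" "w6 + 2 * w7 + w8 \<in> \<int>"
       "w7 + 2 * w8 \<in> \<int>" for w1 w2 w3 w4 w5 w6 w7 w8 :: real
  proof -
    obtain n1 n2 n3 n4 n5 n6 n7 n8 where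
      n: "2 * of_int q * w1 + real p ^ r * of_int v * w2 = of_int n1"
       "of_int v * w1 + 2 * of_int \<xi> * w2 + w3 = of_int n2" "w2 + 2 * w3 + w4 = of_int n3"
       "w3 + 2 * w4 + w5 = of_int n4" "w4 + 2 * w5 + w6 = of_int n5" "w5 + 2 * w6 + w7 = of_int n6"
       "w6 + 2 * w7 + w8 = of_int n7" "w7 + 2 * w8 = of_int n8"
      using n by (auto elim!: Ints_cases)
    \<comment> \<open>Solving the equations upwards in terms of \<open>w8\<close> produces the
      coefficients -2, 3, -4, 5, -6, 7, up to sign the determinants of the trailing blocks of
      \<open>F\<close>. A system in \<open>w1\<close> and \<open>w8\<close> of determinant 1
      remains, solved by Cramer's rule.\<close>
    define k3 where "k3 = n4 - 2 * n5 + 3 * n6 - 4 * n7 + 5 * n8"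
    define k2 where "k2 = n3 - 2 * n4 + 3 * n5 - 4 * n6 + 5 * n7 - 6 * n8"
    have w3: "w3 = of_int k3 - 6 * w8" and w2: "w2 = of_int k2 + 7 * w8"
      using n by (auto simp: k3_def k2_def)
    define u1 where "u1 = n1 - int (p ^ r) * v * k2"
    define u2 where "u2 = n2 - 2 * \<xi> * k2 - k3"
    have u1: "2 * of_int q * w1 + 7 * real p ^ r * of_int v * w8 = of_int u1"
      using n(1) by (simp add: u1_def w2 algebra_simps)
    have u2: "of_int v * w1 + (14 * of_int \<xi> - 6) * w8 = of_int u2"
      using n(2) by (simp add: u2_def w2 w3 algebra_simps)
    have det: "2 * of_int q * (14 * of_int \<xi> - 6) - 7 * real p ^ r * (of_int v)\<^sup>2 = 1"
      using \<xi>' by (simp add: algebra_simps)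
    have "w8 = (2 * of_int q * (14 * of_int \<xi> - 6) - 7 * real p ^ r * (of_int v)\<^sup>2) * w8" unfolding det by simp
    also have "\<dots> = 2 * of_int q * (of_int v * w1 + (14 * of_int \<xi> - 6) * w8)
        - of_int v * (2 * of_int q * w1 + 7 * real p ^ r * of_int v * w8)"
      by (simp add: algebra_simps power2_eq_square)
    also have "\<dots> = of_int (2 * q * u2 - v * u1)" unfolding u1 u2 by simp
    finally have w8: "w8 \<in> \<int>" by (metis Ints_of_int)
    have "w1 = (2 * of_int q * (14 * of_int \<xi> - 6) - 7 * real p ^ r * (of_int v)\<^sup>2) * w1" unfolding det by simp
    also have "\<dots> = (14 * of_int \<xi> - 6) * (2 * of_int q * w1 + 7 * real p ^ r * of_int v * w8)
        - 7 * real p ^ r * of_int v * (of_int v * w1 + (14 * of_int \<xi> - 6) * w8)"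
      by (simp add: algebra_simps power2_eq_square)
    also have "\<dots> = of_int ((14 * \<xi> - 6) * u1 - 7 * int (p ^ r) * v * u2)" unfolding u1 u2 by simp
    finally have "w1 \<in> \<int>" by (metis Ints_of_int)
    then show ?thesis using w8 w2 by simp
  qed
  have one: "(1::int) > 0" by simp
  show ?thesis
    unfolding G
    by (intro conjI; rule discriminant_gram8[OF p t q one pos]) (rule unimod, assumption+)+
qed

text \<open>The nonresidue 5 takes the place of \<open>q\<close>. The trailing 5 by 5 block has
  determinant 6, and the lower 6 by 6 block has determinant 4 * 6 - 5 = 19.\<close>

lemma discriminant_gram8_case_7_nonresidue:
  fixes \<xi> v t a :: int and p r :: nat
  defines "G \<equiv> gram8 (10 * real p ^ r) (real p ^ r * of_int v) (2 * of_int \<xi>) 5 4"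
  assumes p: "p > 0" and t: "[5 * t\<^sup>2 = a] (mod int (p ^ r))" "coprime t (int (p ^ r))"
    and \<xi>: "20 * \<xi> = int (p ^ r) * v\<^sup>2 + 79"
  shows "even_lattice integer_vectors (gram_form G)
    \<and> positive_definite integer_vectors (gram_form G)
    \<and> isometrically_isomorphic (discriminant_module integer_vectors (gram_form G)) (cyclic_module p r a)"
proof -
  have G: "G = gram8 (2 * of_int 5 * real p ^ r) (real p ^ r * of_int v) (2 * of_int \<xi>)
      (of_int 5) (2 * of_int 2)"
    by (simp add: G_def)
  have "real_of_int (20 * \<xi>) = real_of_int (int (p ^ r) * v\<^sup>2 + 79)"
    using \<xi> by (simp only:)
  then have \<xi>': "20 * of_int \<xi> = (real p ^ r) * (of_int v)\<^sup>2 + (79 :: real)"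
    by simp
  \<comment> \<open>The pivot is 79/10 - 150/19 = 1/190, where 150/19 = 25 / (4 - 5/6).\<close>
  then have pos: "2 * of_int \<xi> - real p ^ r * (of_int v)\<^sup>2 / (2 * of_int 5)
      - (of_int 5)\<^sup>2 / (2 * of_int 2 - 5 / 6) > (0 :: real)"
    by (simp add: field_simps)
  have unimod: "w1 \<in> \<int> \<and> w2 \<in> \<int> \<and> w8 \<in> \<int>"
    if n: "2 * of_int 5 * w1 + real p ^ r * of_int v * w2 \<in> \<int>"
       "of_int v * w1 + 2 * of_int \<xi> * w2 + of_int 5 * w3 \<in> \<int>" "of_int 5 * w2 + 2 * of_int 2 * w3 + w4 \<in> \<int>"
       "w3 + 2 * w4 + w5 \<in> \<int>" "w4 + 2 * w5 + w6 \<in> \<int>" "w5 + 2 * w6 + w7 \<in> \<int>" "w6 + 2 * w7 + w8 \<in> \<int>"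
       "w7 + 2 * w8 \<in> \<int>" for w1 w2 w3 w4 w5 w6 w7 w8 :: real
  proof -
    obtain u1 n2 n3 n4 n5 n6 n7 n8 where
      n: "10 * w1 + real p ^ r * of_int v * w2 = of_int u1"
       "of_int v * w1 + 2 * of_int \<xi> * w2 + 5 * w3 = of_int n2" "5 * w2 + 4 * w3 + w4 = of_int n3"
       "w3 + 2 * w4 + w5 = of_int n4" "w4 + 2 * w5 + w6 = of_int n5" "w5 + 2 * w6 + w7 = of_int n6"
       "w6 + 2 * w7 + w8 = of_int n7" "w7 + 2 * w8 = of_int n8"
      using n by (auto elim!: Ints_cases)
    define k3 where "k3 = n4 - 2 * n5 + 3 * n6 - 4 * n7 + 5 * n8"
    define k4 where "k4 = n5 - 2 * n6 + 3 * n7 - 4 * n8"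
    have w3: "w3 = of_int k3 - 6 * w8" and w4: "w4 = of_int k4 + 5 * w8"
      using n by (auto simp: k3_def k4_def)
    define k2 where "k2 = n3 - 4 * k3 - k4"
    define u2 where "u2 = n2 - 5 * k3"
    have k2: "5 * w2 - 19 * w8 = of_int k2"
      using n(3) by (simp add: k2_def w3 w4)
    have u2: "of_int v * w1 + 2 * of_int \<xi> * w2 - 30 * w8 = of_int u2"
      using n(2) by (simp add: u2_def w3)
    define M where "M = real p ^ r"
    have M: "M * (of_int v)\<^sup>2 = 20 * of_int \<xi> - 79" using \<xi>' by (simp add: M_def)
    have "of_int (- 79 * k2 + 50 * u2 - 5 * v * u1) = w8 - 5 * (M * (of_int v)\<^sup>2 - (20 * of_int \<xi> - 79)) * w2"
      by (simp add: k2[symmetric] u2[symmetric] n(1)[symmetric] M_def algebra_simps power2_eq_square)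
    then have "of_int (- 79 * k2 + 50 * u2 - 5 * v * u1) = w8" unfolding M by simp
    then have w8: "w8 \<in> \<int>" by (metis Ints_of_int)
    have "of_int (- 300 * k2 + 190 * u2 - 19 * v * u1) = w2 - 19 * (M * (of_int v)\<^sup>2 - (20 * of_int \<xi> - 79)) * w2"
      by (simp add: k2[symmetric] u2[symmetric] n(1)[symmetric] M_def algebra_simps power2_eq_square)
    then have "of_int (- 300 * k2 + 190 * u2 - 19 * v * u1) = w2" unfolding M by simp
    then have w2: "w2 \<in> \<int>" by (metis Ints_of_int)
    have "of_int (30 * int (p ^ r) * v * k2 - 19 * int (p ^ r) * v * u2 + (38 * \<xi> - 150) * u1)
        = w1 - 19 * (M * (of_int v)\<^sup>2 - (20 * of_int \<xi> - 79)) * w1"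
      by (simp add: k2[symmetric] u2[symmetric] n(1)[symmetric] M_def algebra_simps power2_eq_square)
    then have "of_int (30 * int (p ^ r) * v * k2 - 19 * int (p ^ r) * v * u2 + (38 * \<xi> - 150) * u1) = w1"
      unfolding M by simp
    then have "w1 \<in> \<int>" by (metis Ints_of_int)
    then show ?thesis using w8 w2 by simp
  qed
  have pos5: "(5::int) > 0" "(2::int) > 0" by simp_all
  show ?thesis
    unfolding G
    by (intro conjI; rule discriminant_gram8[OF p t pos5 pos]) (rule unimod, assumption+)+
qed

section \<open>Residues of the shape w^2 + 7 and the choice of parameters\<close>

text \<open>
  Otherwise the squares modulo \<open>p\<close> would be closed under adding \<open>7\<close>, so that every residue
  would be a square.
\<close>

lemma exists_nonresidue_square_add_7:
  fixes a :: int
  assumes p: "prime p" "p \<noteq> 7" and a: "Legendre a (int p) = - 1"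
  shows "\<exists>w. Legendre (w\<^sup>2 + 7) (int p) = - 1"
proof (rule ccontr)
  assume "\<not> ?thesis"
  then have "[w\<^sup>2 + 7 = 0] (mod int p) \<or> QuadRes (int p) (w\<^sup>2 + 7)" for w
    by (metis Legendre_def)
  moreover have "QuadRes (int p) b" if "[b = 0] (mod int p)" for b
    unfolding QuadRes_def using that by (intro exI[of _ 0]) (simp add: cong_sym_eq)
  ultimately have step: "QuadRes (int p) (w\<^sup>2 + 7)" for w by blast
  have "QuadRes (int p) (7 * int k)" for k
  proof (induction k)
    case 0
    show ?case unfolding QuadRes_def by (intro exI[of _ 0]) simp
  next
    case (Suc k)
    then obtain y where y: "[y\<^sup>2 = 7 * int k] (mod int p)" by (auto simp: QuadRes_def)
    obtain z where z: "[z\<^sup>2 = y\<^sup>2 + 7] (mod int p)" using step by (auto simp: QuadRes_def)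
    note z
    also have "[y\<^sup>2 + 7 = 7 * int k + 7] (mod int p)" by (intro cong_add y cong_refl)
    also have "7 * int k + 7 = 7 * int (Suc k)" by simp
    finally show ?case unfolding QuadRes_def by blast
  qed
  \<comment> \<open>7 is invertible modulo \<open>p\<close>, so its multiples reach the nonresidue
    \<open>a\<close>.\<close>
  moreover obtain k where "[7 * int k = a] (mod int p)"
  proof -
    have "prime (7 :: nat)" by simp
    then have "coprime p 7" using p by (metis primes_coprime)
    then have "coprime (7 :: int) (int p)"
      by (metis coprime_commute coprime_int_iff of_nat_numeral)
    then obtain u where u: "[7 * u = 1] (mod int p)" using cong_solve_coprime_int by blast
    have "[7 * int (nat ((u * a) mod int p)) = 7 * (u * a)] (mod int p)"
      using p(1) by (intro cong_mult cong_refl) (simp add: prime_gt_0_nat)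
    also have "7 * (u * a) = (7 * u) * a" by simp
    also have "[(7 * u) * a = 1 * a] (mod int p)" by (intro cong_mult u cong_refl)
    finally show thesis by (simp only: mult_1 that)
  qed
  ultimately have "QuadRes (int p) a" unfolding QuadRes_def by (metis cong_trans)
  with a show False by (auto simp: Legendre_def split: if_splits)
qed

lemma Legendre_cong:
  assumes "[b = c] (mod m)"
  shows "Legendre b m = Legendre c m"
proof -
  have "[b = 0] (mod m) \<longleftrightarrow> [c = 0] (mod m)" "QuadRes m b \<longleftrightarrow> QuadRes m c"
    using assms unfolding QuadRes_def by (metis cong_sym cong_trans)+
  then show ?thesis by (simp add: Legendre_def)
qed

text \<open>Odd \<open>w\<close> makes w^2 + 7 divisible by 4, and \<open>w\<close> congruent to 3
  modulo 7 makes the quotient congruent to 4 modulo 7. Both are compatible with any class modulo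
  \<open>p\<close>, which is coprime to 14. For a residue \<open>a\<close>, \<open>w = 3\<close>
  gives the square 16.\<close>

lemma exists_square_add_7_with_Legendre:
  fixes a :: int
  assumes p: "prime p" "odd p" "p \<noteq> 7" and a: "\<not> int p dvd a"
  obtains w where "odd w" "[w = 3] (mod 7)" "Legendre (w\<^sup>2 + 7) (int p) = Legendre a (int p)"
proof (cases "QuadRes (int p) a")
  case True
  then have a1: "Legendre a (int p) = 1" using a by (simp add: Legendre_def cong_0_iff)
  have "QuadRes (int p) 16" unfolding QuadRes_def by (intro exI[of _ 4]) simp
  moreover have "\<not> int p dvd 16"
  proof
    assume "int p dvd 16"
    then have "int p dvd 2 ^ 4" by simp
    then have "int p dvd 2" using p(1) by (metis prime_dvd_power prime_nat_int_transfer)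
    then have "p dvd 2" by (metis int_dvd_int_iff of_nat_numeral)
    then show False using p by (metis primes_dvd_imp_eq two_is_prime_nat dvd_refl)
  qed
  ultimately have "Legendre (3\<^sup>2 + 7) (int p) = 1" by (simp add: Legendre_def cong_0_iff)
  then show thesis using that[of 3] a1 by simp
next
  case False
  then have am: "Legendre a (int p) = - 1" using a by (simp add: Legendre_def cong_0_iff)
  then obtain w0 where w0: "Legendre (w0\<^sup>2 + 7) (int p) = - 1"
    using exists_nonresidue_square_add_7 p by blast
  have "coprime p 7" using p by (intro primes_coprime) auto
  moreover have "coprime p 2" using p(2) by simp
  ultimately have "coprime p (7 * 2)" using coprime_mult_right_iff by blast
  then have "coprime (int p) (int (7 * 2))" by (simp only: coprime_int_iff)
  then have "coprime (int p) 14" by simp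
  then obtain w where w: "[w = w0] (mod int p)" "[w = 3] (mod 14)"
    using binary_chinese_remainder_int by blast
  have "[w = 3] (mod 7)" using w(2) by (rule cong_dvd_modulus) simp
  moreover have "odd w"
  proof -
    have "[w = 3] (mod 2)" using w(2) by (rule cong_dvd_modulus) simp
    then show ?thesis by (simp add: cong_def odd_iff_mod_2_eq_one)
  qed
  moreover have "Legendre (w\<^sup>2 + 7) (int p) = Legendre (w0\<^sup>2 + 7) (int p)"
    by (intro Legendre_cong cong_add cong_pow w cong_refl)
  ultimately show thesis using that w0 am by simp
qed

text \<open>The right-hand side is divisible by \<open>4 * q\<close> by the choice of
  \<open>m\<close>, and by 7 because 12 * 4 + 1 = 49; the two moduli are coprime.\<close>

lemma gram8_entry_integral:
  fixes q m :: int
  assumes q: "[q = 4] (mod 7)" and m: "[7 * m = - 1] (mod (4 * q))"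
  shows "\<exists>\<xi>. 28 * q * \<xi> = 7 * m + 12 * q + 1"
proof -
  have q7: "q mod 7 = 4" using q by (simp add: cong_def)
  have "4 * q dvd 7 * m + 1" using m by (simp add: cong_iff_dvd_diff)
  moreover have "4 * q dvd 12 * q" by (rule dvdI[of _ _ 3]) simp
  ultimately have "4 * q dvd (7 * m + 1) + 12 * q" by (rule dvd_add)
  moreover have "7 dvd (7 * m + 1) + 12 * q" using q7 by presburger
  moreover have "coprime 7 (4 * q)"
  proof -
    have "\<not> 7 dvd 4 * q" using q7 by presburger
    then show ?thesis by (intro prime_imp_coprime) auto
  qed
  ultimately have "7 * (4 * q) dvd (7 * m + 1) + 12 * q" by (metis divides_mult)
  then show ?thesis unfolding dvd_def by (auto simp: algebra_simps)
qed

text \<open>With 4 q = w^2 + 7, \<open>w\<close> is a square root of - 7 modulo 4 q. As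
  \<open>r\<close> is even, v = w / (7 p^(r/2)) makes sense modulo 4 q and satisfies 7 p^r v^2 = - 1
  there.\<close>

lemma exists_gram8_parameters:
  fixes a :: int
  assumes p: "prime p" "odd p" "p \<noteq> 7" and a: "\<not> int p dvd a" and r: "even r"
  obtains q \<xi> v t :: int where "q > 0" "[q * t\<^sup>2 = a] (mod int (p ^ r))" "coprime t (int (p ^ r))"
    "28 * q * \<xi> = 7 * int (p ^ r) * v\<^sup>2 + 12 * q + 1"
proof -
  obtain w where w: "odd w" "[w = 3] (mod 7)" "Legendre (w\<^sup>2 + 7) (int p) = Legendre a (int p)"
    using exists_square_add_7_with_Legendre[OF p a] .
  obtain t where t: "[(w\<^sup>2 + 7) * t\<^sup>2 = a] (mod int (p ^ r))" "coprime t (int (p ^ r))"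
    using Legendre_eq_imp_square_multiple[OF p(1,2) a w(3)] .
  obtain j where j: "w = 2 * j + 1" using w(1) by (auto elim: oddE)
  define q where "q = j * j + j + 2"
  have q4: "w\<^sup>2 + 7 = 4 * q" by (simp add: j q_def power2_eq_square algebra_simps)
  have "0 < w\<^sup>2 + 7" by (rule add_nonneg_pos) simp_all
  then have q: "q > 0" using q4 by simp
  \<comment> \<open>w^2 + 7 and \<open>q\<close> differ by the square 4, which is absorbed by
    doubling \<open>t\<close>.\<close>
  have "coprime (2 * t) (int (p ^ r))" using t(2) p(2) by simp
  moreover have "[q * (2 * t)\<^sup>2 = a] (mod int (p ^ r))"
  proof -
    have "q * (2 * t)\<^sup>2 = (w\<^sup>2 + 7) * t\<^sup>2" unfolding q4 by (simp add: power2_eq_square)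
    with t(1) show ?thesis by (simp only:)
  qed
  moreover have "\<exists>\<xi> v. 28 * q * \<xi> = 7 * int (p ^ r) * v\<^sup>2 + 12 * q + 1"
  proof -
    have w7: "[4 * q = 2] (mod 7)"
    proof -
      have "[w\<^sup>2 + 7 = 3\<^sup>2 + 7] (mod 7)" by (intro cong_add cong_pow w cong_refl)
      then show ?thesis unfolding q4 by (simp add: cong_def)
    qed
    then have q7: "[q = 4] (mod 7)" by (simp add: cong_def) presburger
    have c7: "coprime (7 :: int) (4 * q)"
    proof -
      have "\<not> 7 dvd 4 * q" using w7 by (simp add: cong_def dvd_eq_mod_eq_0)
      then show ?thesis by (intro prime_imp_coprime) auto
    qed
    have cp: "coprime (int p) (4 * q)"
    proof -
      have "\<not> int p dvd w\<^sup>2 + 7"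
        using w(3) a by (auto simp: Legendre_def cong_0_iff split: if_splits)
      then show ?thesis using p(1) unfolding q4 by (intro prime_imp_coprime) auto
    qed
    have "coprime (7 * int p ^ (r div 2)) (4 * q)"
      using c7 cp by (metis coprime_mult_left_iff coprime_power_left_iff)
    then obtain u where u: "[7 * int p ^ (r div 2) * u = 1] (mod (4 * q))"
      using cong_solve_coprime_int by blast
    define v where "v = u * w"
    have "7 * (7 * int (p ^ r) * v\<^sup>2) = (7 * int p ^ (r div 2) * u)\<^sup>2 * w\<^sup>2"
    proof -
      have "int (p ^ r) = (int p ^ (r div 2))\<^sup>2" using r by (simp flip: power_mult)
      then show ?thesis by (simp add: v_def power_mult_distrib)
    qed
    also have "[\<dots> = 1\<^sup>2 * w\<^sup>2] (mod (4 * q))" by (intro cong_mult cong_pow u cong_refl)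
    also have "1\<^sup>2 * w\<^sup>2 = 7 * (- 1) + 4 * q" using q4 by simp
    also have "[7 * (- 1) + 4 * q = 7 * (- 1)] (mod (4 * q))" by (simp add: cong_def)
    finally have "[7 * int (p ^ r) * v\<^sup>2 = - 1] (mod (4 * q))"
      using c7 by (simp only: cong_mult_lcancel)
    then show ?thesis using gram8_entry_integral[OF q7, of "int (p ^ r) * v\<^sup>2"]
      by (metis mult.assoc)
  qed
  ultimately show thesis using that q by blast
qed

text \<open>The first three parts take \<open>q\<close> and \<open>v\<close> as given, so the least
  rank needs a witness of its own; the lower bound ranges over lattices in any real vector
  space.\<close>

theorem theorem5p6:
  fixes p r :: nat and a :: int
  assumes "prime p" and "odd p" and "gcd a (int p) = 1" and "even r" and "r > 0"
  shows
    "(p \<noteq> 7 \<longrightarrow>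
        (\<forall>(q::nat) (v::int) (x::real) G.
           prime q \<and> [q = 4] (mod 7) \<and> Legendre (int q) (int p) = Legendre a (int p) \<and>
           [7 * int p ^ r * v\<^sup>2 = - 1] (mod (4 * int q)) \<and>
           x = (7 * real p ^ r * (of_int v)\<^sup>2 + 12 * real q + 1) / (28 * real q) \<and>
           G = gram8 (2 * real q * real p ^ r) (real p ^ r * of_int v) (2 * x) 1 2 \<longrightarrow>
             even_lattice integer_vectors (gram_form G) \<and>
             positive_definite integer_vectors (gram_form G) \<and>
             isometrically_isomorphic
               (discriminant_module integer_vectors (gram_form G)) (cyclic_module p r a)))
     \<and> (p = 7 \<and> Legendre a 7 = 1 \<longrightarrow>
        (\<forall>(v::int) (x::real) G.
           [7 ^ (r - 1) * v\<^sup>2 = - 1] (mod 16) \<and>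
           x = (7 ^ r * (of_int v)\<^sup>2 + 7) / 16 \<and>
           G = gram8 (8 * 7 ^ r) (7 ^ r * of_int v) (2 * x) 1 2 \<longrightarrow>
             even_lattice integer_vectors (gram_form G) \<and>
             positive_definite integer_vectors (gram_form G) \<and>
             isometrically_isomorphic
               (discriminant_module integer_vectors (gram_form G)) (cyclic_module 7 r a)))
     \<and> (p = 7 \<and> Legendre a 7 = - 1 \<longrightarrow>
        (\<forall>(v::int) (x::real) G.
           [7 ^ r * v\<^sup>2 = 1] (mod 20) \<and>
           x = (7 ^ r * (of_int v)\<^sup>2 + 79) / 20 \<and>
           G = gram8 (10 * 7 ^ r) (7 ^ r * of_int v) (2 * x) 5 4 \<longrightarrow>
             even_lattice integer_vectors (gram_form G) \<and>
             positive_definite integer_vectors (gram_form G) \<and>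
             isometrically_isomorphic
               (discriminant_module integer_vectors (gram_form G)) (cyclic_module 7 r a)))
     \<and> (\<exists>(L :: (real ^ 8) set) B.
           even_lattice L B \<and> positive_definite L B \<and>
           isometrically_isomorphic (discriminant_module L B) (cyclic_module p r a) \<and>
           lattice_rank L = 8)
     \<and> (\<forall>(L :: 'v::real_vector set) B.
           even_lattice L B \<and> positive_definite L B \<and>
           isometrically_isomorphic (discriminant_module L B) (cyclic_module p r a) \<longrightarrow>
           8 \<le> lattice_rank L)"
proof -
  have p0: "p > 0" using assms(1) by (rule prime_gt_0_nat)
  have a: "\<not> int p dvd a"
  proof
    assume "int p dvd a"
    then have "int p dvd gcd a (int p)" by simp
    then show False using assms(1,3) by (simp add: not_prime_unit)
  qed
  have r: "7 ^ r = (7 :: int) * 7 ^ (r - 1)" using assms(5) by (simp flip: power_Suc)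
  have part1: "even_lattice integer_vectors (gram_form G) \<and> positive_definite integer_vectors (gram_form G) \<and>
      isometrically_isomorphic (discriminant_module integer_vectors (gram_form G)) (cyclic_module p r a)"
    if "[q = 4] (mod 7)" and L: "Legendre (int q) (int p) = Legendre a (int p)"
      and v: "[7 * int p ^ r * v\<^sup>2 = - 1] (mod (4 * int q))"
      and x: "x = (7 * real p ^ r * (of_int v)\<^sup>2 + 12 * real q + 1) / (28 * real q)"
      and G: "G = gram8 (2 * real q * real p ^ r) (real p ^ r * of_int v) (2 * x) 1 2" for q v x G
  proof -
    have q7: "int q mod 7 = 4" using that(1) by (simp add: cong_def) presburger
    then have q: "int q > 0" by presburger
    obtain t where t: "[int q * t\<^sup>2 = a] (mod int (p ^ r))" "coprime t (int (p ^ r))"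
      using Legendre_eq_imp_square_multiple[OF assms(1,2) a L] .
    have "[7 * (int (p ^ r) * v\<^sup>2) = - 1] (mod (4 * int q))"
      using v by (simp add: mult.assoc)
    then obtain \<xi> where \<xi>: "28 * int q * \<xi> = 7 * int (p ^ r) * v\<^sup>2 + 12 * int q + 1"
      using gram8_entry_integral[of "int q" "int (p ^ r) * v\<^sup>2"] q7
      by (auto simp: cong_def mult.assoc)
    have "real_of_int (28 * int q * \<xi>) = real_of_int (7 * int (p ^ r) * v\<^sup>2 + 12 * int q + 1)"
      using \<xi> by (simp only:)
    then have "x = of_int \<xi>" unfolding x using q by (simp add: field_simps)
    then show ?thesis using discriminant_gram8_F[OF p0 t q \<xi>] G by simp
  qed
  have part2: "even_lattice integer_vectors (gram_form G) \<and> positive_definite integer_vectors (gram_form G) \<and>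
      isometrically_isomorphic (discriminant_module integer_vectors (gram_form G)) (cyclic_module 7 r a)"
    if p: "p = 7" and L: "Legendre a 7 = 1" and v: "[7 ^ (r - 1) * v\<^sup>2 = - 1] (mod 16)"
      and x: "x = (7 ^ r * (of_int v)\<^sup>2 + 7) / 16"
      and G: "G = gram8 (8 * 7 ^ r) (7 ^ r * of_int v) (2 * x) 1 2" for v x G
  proof -
    have "QuadRes 7 4" unfolding QuadRes_def by (intro exI[of _ 2]) simp
    then have "Legendre 4 7 = 1" by (simp add: Legendre_def cong_def)
    then have "Legendre 4 (int p) = Legendre a (int p)" using L p by simp
    then obtain t where t: "[4 * t\<^sup>2 = a] (mod int (p ^ r))" "coprime t (int (p ^ r))"
      using Legendre_eq_imp_square_multiple[OF assms(1,2) a] by metis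
    have "16 dvd 7 ^ (r - 1) * v\<^sup>2 + 1" using v by (simp add: cong_iff_dvd_diff)
    then obtain k where k: "7 ^ (r - 1) * v\<^sup>2 + 1 = 16 * k" by (auto elim: dvdE)
    \<comment> \<open>The relation of \<open>discriminant_gram8_F\<close> for \<open>q = 4\<close>;
      the condition modulo 16 gives the entry \<open>7 * k\<close>.\<close>
    have \<xi>: "28 * 4 * (7 * k) = 7 * int (p ^ r) * v\<^sup>2 + 12 * 4 + 1"
      using k by (simp add: p r)
    then have "real_of_int (28 * 4 * (7 * k)) = real_of_int (7 * int (p ^ r) * v\<^sup>2 + 12 * 4 + 1)"
      by (simp only:)
    then have "x = of_int (7 * k)" unfolding x by (simp add: p field_simps)
    then show ?thesis using discriminant_gram8_F[OF p0 t _ \<xi>] G p by simp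
  qed
  have part3: "even_lattice integer_vectors (gram_form G) \<and> positive_definite integer_vectors (gram_form G) \<and>
      isometrically_isomorphic (discriminant_module integer_vectors (gram_form G)) (cyclic_module 7 r a)"
    if p: "p = 7" and L: "Legendre a 7 = - 1" and v: "[7 ^ r * v\<^sup>2 = 1] (mod 20)"
      and x: "x = (7 ^ r * (of_int v)\<^sup>2 + 79) / 20"
      and G: "G = gram8 (10 * 7 ^ r) (7 ^ r * of_int v) (2 * x) 5 4" for v x G
  proof -
    have "\<not> QuadRes 7 5"
    proof
      assume "QuadRes 7 5"
      then obtain y :: int where "y\<^sup>2 mod 7 = 5" by (auto simp: QuadRes_def cong_def)
      then have "(y mod 7)\<^sup>2 mod 7 = 5" by (simp add: power_mod)
      moreover have "y mod 7 \<in> {0, 1, 2, 3, 4, 5, 6}" by auto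
      ultimately show False by auto
    qed
    then have "Legendre 5 7 = - 1" by (simp add: Legendre_def cong_def)
    then have "Legendre 5 (int p) = Legendre a (int p)" using L p by simp
    then obtain t where t: "[5 * t\<^sup>2 = a] (mod int (p ^ r))" "coprime t (int (p ^ r))"
      using Legendre_eq_imp_square_multiple[OF assms(1,2) a] by metis
    have "20 dvd 7 ^ r * v\<^sup>2 - 1" using v by (simp add: cong_iff_dvd_diff)
    then obtain k where k: "7 ^ r * v\<^sup>2 - 1 = 20 * k" by (auto elim: dvdE)
    have \<xi>: "20 * (k + 4) = int (p ^ r) * v\<^sup>2 + 79"
      using k by (simp add: p)
    then have "real_of_int (20 * (k + 4)) = real_of_int (int (p ^ r) * v\<^sup>2 + 79)"
      by (simp only:)
    then have "x = of_int (k + 4)" unfolding x by (simp add: p field_simps)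
    then show ?thesis using discriminant_gram8_case_7_nonresidue[OF p0 t \<xi>] G p by simp
  qed
  have part4: "\<exists>B. even_lattice (integer_vectors :: (real ^ 8) set) B \<and> positive_definite integer_vectors B \<and>
      isometrically_isomorphic (discriminant_module integer_vectors B) (cyclic_module p r a)"
  proof (cases "p = 7")
    case False
    obtain q \<xi> v t :: int where *: "q > 0" "[q * t\<^sup>2 = a] (mod int (p ^ r))" "coprime t (int (p ^ r))"
      "28 * q * \<xi> = 7 * int (p ^ r) * v\<^sup>2 + 12 * q + 1"
      using exists_gram8_parameters[OF assms(1,2) False a assms(4)] .
    show ?thesis using discriminant_gram8_F[OF p0 *(2,3,1,4)] by blast
  next
    case True
    obtain s where s: "r = 2 * s" using assms(4) by (auto elim: evenE)
    have "Legendre a 7 = 1 \<or> Legendre a 7 = - 1"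
      using a True by (auto simp: Legendre_def cong_0_iff)
    then show ?thesis
    proof
      assume L: "Legendre a 7 = 1"
      obtain s' where s': "s = Suc s'" using s assms(5) by (cases s) auto
      \<comment> \<open>\<open>v = 3\<close> works because 7 * 9 = 63 is - 1 and 49 is 1 modulo
        16.\<close>
      have "[(7 ^ 2) ^ s' * (7 * 3\<^sup>2) = 1 ^ s' * (- 1 :: int)] (mod 16)"
        by (intro cong_mult cong_pow) (simp_all add: cong_def)
      moreover have "r - 1 = Suc (2 * s')" using s s' by simp
      then have "7 ^ (r - 1) * 3\<^sup>2 = (7 ^ 2) ^ s' * (7 * 3\<^sup>2 :: int)"
        by (simp add: power_mult)
      ultimately have "[7 ^ (r - 1) * 3\<^sup>2 = (- 1 :: int)] (mod 16)"
        by (simp only: power_one mult_1)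
      from part2[OF True L this refl refl] show ?thesis unfolding True by blast
    next
      assume L: "Legendre a 7 = - 1"
      \<comment> \<open>\<open>v = 3 ^ s\<close> turns 7^r v^2 into 21^r, which is 1 modulo
        20.\<close>
      have "[(7 * 3) ^ r = 1 ^ r] (mod (20 :: int))"
        by (intro cong_pow) (simp add: cong_def)
      moreover have "(3 ^ s)\<^sup>2 = (3 :: int) ^ r" by (simp add: s mult.commute flip: power_mult)
      then have "7 ^ r * (3 ^ s)\<^sup>2 = (7 * 3 :: int) ^ r" by (simp only: power_mult_distrib)
      ultimately have "[7 ^ r * (3 ^ s)\<^sup>2 = 1] (mod (20 :: int))"
        by (simp only: power_one)
      from part3[OF True L this refl refl] show ?thesis unfolding True by blast
    qed
  qed
  have part5: "8 \<le> lattice_rank L"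
    if "even_lattice L B" "positive_definite L B"
      "isometrically_isomorphic (discriminant_module L B) (cyclic_module p r a)"
    for L :: "'v set" and B
    using even_lattice_space.cyclic_discriminant_rank_ge_8[OF even_lattice_spaceI[OF that(1)] that(2,3) assms(1,2,4,5)] .
  show ?thesis
    using part1 part2 part3 part4 part5 lattice_rank_integer_vectors by blast
qed

end
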